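(* Suppose that $\sum_{n\geq 1}|\rho_n|<\infty$. Then $$h_c^a(\beta)\ \sim\ -\frac{\beta^2}{2}\Big(1+2\sum_{n\geq 1}\rho_n P(n\in\tau)\Big)\quad\text{as }\beta\searrow 0,$$ where $\sim$ means that the ratio of the two sides tends to $1$.
   Context: Let $(T_n)_{n\geq 1}$ be i.i.d. random variables with values in $\mathbb{N}^*=\{1,2,\dots\}$ under a law $P$ (expectation $E$), with $K(n):=P(T_1=n)=L(n)n^{-(1+\alpha)}>0$ for all $n\ge1$, where $\alpha\geq 0$, $L$ is a slowly varying function (at infinity), and $\sum_{n\geq 1}K(n)=1$. Let $\tau_0=0$, $\tau_n=T_1+\cdots+T_n$, let $\tau=\{\tau_k: k\ge 0\}$ be the renewal process, and $\delta_n:=\mathbf{1}_{\{n\in\tau\}}$. Let $\omega=(\omega_n)_{n\geq 0}$ be a stationary Gaussian sequence (law $\mathbb{P}$, expectation $\mathbb{E}$), independent of $\tau$, with $\mathbb{E}(\omega_0)=0$, $\mathbb{E}(\omega_0^2)=1$, and let $\rho_n:=\operatorname{Cov}(\omega_0,\omega_n)$ for $n\ge1$. For $\beta\geq 0$, $h\in\mathbb{R}$, $n\ge1$, the annealed partition function is $$Z^a_{n,\beta,h}:=\mathbb{E}\,E\Big[\exp\Big(\sum_{k=1}^n(\beta\omega_k+h)\delta_k\Big)\delta_n\Big]=E\Big[\exp\Big(\big(h+\tfrac{\beta^2}{2}\big)\sum_{k=1}^n\delta_k+\beta^2\sum_{1\leq k<l\leq n}\rho_{l-k}\delta_k\delta_l\Big)\delta_n\Big].$$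 The annealed free energy is $F^a(\beta,h):=\lim_{n\to+\infty}\frac1n\log Z^a_{n,\beta,h}$, which exists and is finite whenever $\sum_{n}|\rho_n|<\infty$, and the annealed critical point is $h_c^a(\beta):=\sup\{h\in\mathbb{R}: F^a(\beta,h)=0\}$. *)

theory Defs
  imports "HOL-Probability.Probability"
begin

(* Karamata's convention: L is only required to be positive and measurable near infinity. *)
definition slowly_varying :: "(real \<Rightarrow> real) \<Rightarrow> bool" where
  "slowly_varying L \<longleftrightarrow>
     (\<exists>X. (\<forall>x\<ge>X. L x > 0) \<and> L \<in> borel_measurable (restrict_space borel {X..})) \<and>
     (\<forall>c>0. ((\<lambda>x. L (c * x) / L x) \<longlongrightarrow> 1) at_top)"

(* Degenerate (almost surely constant) variables count as Gaussian, as is usual for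
   Gaussian processes. *)
definition gaussian_rv :: "'a measure \<Rightarrow> ('a \<Rightarrow> real) \<Rightarrow> bool" where
  "gaussian_rv M X \<longleftrightarrow> X \<in> borel_measurable M \<and>
     ((\<exists>\<mu> \<sigma>. \<sigma> > 0 \<and> distributed M lborel X (normal_density \<mu> \<sigma>)) \<or>
      (\<exists>\<mu>. AE x in M. X x = \<mu>))"

definition gaussian_sequence :: "'a measure \<Rightarrow> (nat \<Rightarrow> 'a \<Rightarrow> real) \<Rightarrow> bool" where
  "gaussian_sequence M \<omega> \<longleftrightarrow>
     (\<forall>(c :: nat \<Rightarrow> real) N. gaussian_rv M (\<lambda>x. \<Sum>i\<le>N. c i * \<omega> i x))"

definition stationary_sequence :: "'a measure \<Rightarrow> (nat \<Rightarrow> 'a \<Rightarrow> real) \<Rightarrow> bool" where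
  "stationary_sequence M \<omega> \<longleftrightarrow>
     (\<forall>i. \<omega> i \<in> borel_measurable M) \<and>
     (\<forall>m. distr M (Pi\<^sub>M UNIV (\<lambda>_. borel)) (\<lambda>x i. \<omega> (i + m) x) =
          distr M (Pi\<^sub>M UNIV (\<lambda>_. borel)) (\<lambda>x i. \<omega> i x))"

definition covariance :: "'a measure \<Rightarrow> ('a \<Rightarrow> real) \<Rightarrow> ('a \<Rightarrow> real) \<Rightarrow> real" where
  "covariance M X Y =
     (LINT x|M. (X x - (LINT y|M. X y)) * (Y x - (LINT y|M. Y y)))"

(* The variables T are indexed from 1; T 0 is never used. *)
definition iid_interarrivals :: "'a measure \<Rightarrow> (nat \<Rightarrow> 'a \<Rightarrow> nat) \<Rightarrow> bool" where
  "iid_interarrivals M T \<longleftrightarrow>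
     prob_space.indep_vars M (\<lambda>_. count_space UNIV) T {1..} \<and>
     (\<forall>i\<ge>1. distr M (count_space UNIV) (T i) = distr M (count_space UNIV) (T 1)) \<and>
     (\<forall>i\<ge>1. \<forall>x\<in>space M. T i x \<ge> 1)"

(* The renewal and the disorder live on one probability space; independence is that of the
   sigma-algebras generated by the two whole sequences (the library's indep_var
   would require both to take values in the same type). *)
definition indep_sequences ::
    "'a measure \<Rightarrow> (nat \<Rightarrow> 'a \<Rightarrow> nat) \<Rightarrow> (nat \<Rightarrow> 'a \<Rightarrow> real) \<Rightarrow> bool" where
  "indep_sequences M T \<omega> \<longleftrightarrow>
     prob_space.indep_set M
       (sets (vimage_algebra (space M) (\<lambda>x. \<lambda>i\<in>{1..}. T i x)
                (Pi\<^sub>M {1..} (\<lambda>_. count_space UNIV))))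
       (sets (vimage_algebra (space M) (\<lambda>x i. \<omega> i x) (Pi\<^sub>M UNIV (\<lambda>_. borel))))"

definition renewal_time :: "(nat \<Rightarrow> 'a \<Rightarrow> nat) \<Rightarrow> nat \<Rightarrow> 'a \<Rightarrow> nat" where
  "renewal_time T k x = (\<Sum>i=1..k. T i x)"

definition renewal_set :: "(nat \<Rightarrow> 'a \<Rightarrow> nat) \<Rightarrow> 'a \<Rightarrow> nat set" where
  "renewal_set T x = {renewal_time T k x | k. True}"

definition contact :: "(nat \<Rightarrow> 'a \<Rightarrow> nat) \<Rightarrow> nat \<Rightarrow> 'a \<Rightarrow> real" where
  "contact T n x = indicator (renewal_set T x) n"

definition annealed_Z ::
    "'a measure \<Rightarrow> (nat \<Rightarrow> 'a \<Rightarrow> nat) \<Rightarrow> (nat \<Rightarrow> 'a \<Rightarrow> real) \<Rightarrow> real \<Rightarrow> real \<Rightarrow> nat \<Rightarrow> real" where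
  "annealed_Z M T \<omega> \<beta> h n =
     (LINT x|M. exp (\<Sum>k=1..n. (\<beta> * \<omega> k x + h) * contact T k x) * contact T n x)"

definition annealed_free_energy ::
    "'a measure \<Rightarrow> (nat \<Rightarrow> 'a \<Rightarrow> nat) \<Rightarrow> (nat \<Rightarrow> 'a \<Rightarrow> real) \<Rightarrow> real \<Rightarrow> real \<Rightarrow> real" where
  "annealed_free_energy M T \<omega> \<beta> h = lim (\<lambda>n. 1 / real n * ln (annealed_Z M T \<omega> \<beta> h n))"

definition annealed_critical_point ::
    "'a measure \<Rightarrow> (nat \<Rightarrow> 'a \<Rightarrow> nat) \<Rightarrow> (nat \<Rightarrow> 'a \<Rightarrow> real) \<Rightarrow> real \<Rightarrow> real" where
  "annealed_critical_point M T \<omega> \<beta> = Sup {h. annealed_free_energy M T \<omega> \<beta> h = 0}"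

end

(* A contact configuration is the list of gaps t_1, ..., t_m of the renewal; integrating out the
   Gaussian disorder leaves the weight K(t_1)...K(t_m) exp (H m + b V) with H = h + b / 2,
   b = beta^2 and V the sum of rho over all pairs of contacts.  Almost supermultiplicativity of the
   partition function gives the free energy.  Let kappa be the sum of rho_n P(n in tau).  After
   cutting rho at a finite range, adding one gap multiplies the expectation of
   exp (b (V + psi)) by exp (b kappa + O(b^2)) from above and by at least almost exp (b kappa) from
   below, where psi is an explicit bounded corrector solving a Poisson equation.  Hence the critical
   value of H is - b kappa + o(b).  The constant 1 + 2 kappa does not vanish: m + 2 V is the variance
   of the sum of the disorder over the contacts, and exchanging two consecutive gaps moves a single
   contact, which forces this variance to grow linearly in m on average. *)
theory Submission
  imports Defs "HOL-Real_Asymp.Real_Asymp"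
begin

text \<open>The corrector has to be bounded. For \<rho> that is merely summable its potential, the
  sum over n of P(n in tau) \<rho>(n + s), need not be summable in s; hence the cut at range N
  before the corrector is built. The cut costs at most \<open>b * tail \<rho> N\<close> per contact,
  a small multiple of b, and b is the order at which the critical value is sought. Both estimates
  concern m gaps with the endpoint left free, and the way back to paths ending at n differs between
  the two sides. At H slightly below - b \<kappa>, every m <= n contributes a bounded amount to the
  partition function. At H slightly above, gaps are capped at R, so that m gaps end no later than R
  m and growth in m becomes growth in n; the cap loses kernel mass, and R is taken large depending
  on b. That the free energy is 0, and not negative, on the first side comes from slow variation: a
  single jump to n has subexponential cost.\<close>

section \<open>Lists of gaps\<close>

(* A renewal path is encoded by the list of its gaps; psum f s sums f over its points when the
   path starts from s, the starting point itself excluded. *)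
definition compositions :: "nat \<Rightarrow> nat list set" where
  "compositions n = {ts. sum_list ts = n \<and> 0 \<notin> set ts}"

definition words :: "nat \<Rightarrow> nat \<Rightarrow> nat list set" where
  "words R m = {ts. length ts = m \<and> set ts \<subseteq> {1..R}}"

fun psum :: "(nat \<Rightarrow> real) \<Rightarrow> nat \<Rightarrow> nat list \<Rightarrow> real" where
  "psum f s [] = 0"
| "psum f s (t # ts) = f (s + t) + psum f (s + t) ts"

text \<open>The first gap only places the first contact. Seen from there, the later contacts sit at
  the partial sums of the remaining list, so each pair of contacts is counted once and the origin 0
  never takes part.\<close>

fun energy :: "(nat \<Rightarrow> real) \<Rightarrow> nat list \<Rightarrow> real" where
  "energy f [] = 0"
| "energy f (t # ts) = psum f 0 ts + energy f ts"

text \<open>The sum starts at index s + 1, the first point that a path started from s can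
  reach.\<close>

definition tail :: "(nat \<Rightarrow> real) \<Rightarrow> nat \<Rightarrow> real" where
  "tail f s = (\<Sum>k. \<bar>f (k + Suc s)\<bar>)"

lemma length_le_sum_list: "0 \<notin> set ts \<Longrightarrow> length ts \<le> sum_list (ts :: nat list)"
  by (induction ts) auto

lemma entry_le_sum_list: "t \<in> set ts \<Longrightarrow> t \<le> sum_list (ts :: nat list)"
  by (induction ts) auto

lemma finite_words: "finite (words R m)"
proof -
  have "words R m = {ts. set ts \<subseteq> {1..R} \<and> length ts = m}"
    by (auto simp: words_def)
  then show ?thesis by (simp add: finite_lists_length_eq)
qed

lemma composition_in_words:
  assumes "ts \<in> compositions n" "n \<le> R"
  shows "ts \<in> words R (length ts)"
  using assms entry_le_sum_list[of _ ts]
  by (fastforce simp: words_def compositions_def Suc_le_eq intro: gr0I)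

lemma compositions_subset_words: "compositions n \<subseteq> (\<Union>m\<le>n. words n m)"
  using composition_in_words[of _ n n] length_le_sum_list
  by (fastforce simp: compositions_def)

lemma finite_compositions: "finite (compositions n)"
  by (rule finite_subset[OF compositions_subset_words]) (simp add: finite_words)

lemma words_subset_compositions: "words R m \<subseteq> (\<Union>n\<le>R * m. compositions n)"
proof
  fix ts assume ts: "ts \<in> words R m"
  have "sum_list ts \<le> R * length ts" if "set ts \<subseteq> {1..R}" for ts
    using that by (induction ts) auto
  with ts have "sum_list ts \<le> R * m" "0 \<notin> set ts"
    by (auto simp: words_def)
  then show "ts \<in> (\<Union>n\<le>R * m. compositions n)"
    by (auto simp: compositions_def)
qed

lemma words_0: "words R 0 = {[]}"
  by (auto simp: words_def)

lemma sum_words_Suc: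
  "(\<Sum>ts\<in>words R (Suc m). f ts) = (\<Sum>ts\<in>words R m. \<Sum>t=1..R. f (t # ts))"
proof -
  have "words R (Suc m) = (\<lambda>(ts, t). t # ts) ` (words R m \<times> {1..R})"
    by (auto simp: words_def length_Suc_conv image_iff)
  moreover have "inj_on (\<lambda>(ts, t). t # ts) (words R m \<times> {1..R})"
    by (auto simp: inj_on_def)
  ultimately show ?thesis
    by (simp add: sum.reindex sum.cartesian_product case_prod_unfold)
qed

lemma words_mono: "R \<le> R' \<Longrightarrow> words R m \<subseteq> words R' m"
  by (auto simp: words_def)

lemma compositions_0: "compositions 0 = {[]}"
  by (auto simp: compositions_def) (metis list.set_intros(1) neq_Nil_conv)

lemma sum_compositions_rec:
  assumes "n \<ge> 1"
  shows "(\<Sum>ts\<in>compositions n. f ts) = (\<Sum>t=1..n. \<Sum>ts\<in>compositions (n - t). f (t # ts))"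
proof -
  have "(\<Sum>ts\<in>compositions n. f ts) =
        (\<Sum>(t, ts)\<in>(SIGMA t:{1..n}. compositions (n - t)). f (t # ts))"
    using assms
    by (intro sum.reindex_bij_witness[where j = "\<lambda>ts. (hd ts, tl ts)" and i = "\<lambda>(t, ts). t # ts"])
       (auto simp: compositions_def neq_Nil_conv Suc_le_eq,
         (metis gr0I hd_Cons_tl list.set_intros(1) list.set_sel(2) sum_list.Cons sum_list.Nil
            less_not_refl add_diff_cancel_left' le_add1)+)
  also have "\<dots> = (\<Sum>t=1..n. \<Sum>ts\<in>compositions (n - t). f (t # ts))"
    by (simp add: sum.Sigma finite_compositions)
  finally show ?thesis .
qed

lemma psum_append: "psum f s (ts @ us) = psum f s ts + psum f (s + sum_list ts) us"
  by (induction ts arbitrary: s) (auto simp: add_ac)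

lemma psum_diff: "psum (\<lambda>n. f n - g n) s ts = psum f s ts - psum g s ts"
  by (induction ts arbitrary: s) auto

lemma psum_sum: "psum (\<lambda>n. \<Sum>t\<in>A. c t * f t n) s ts = (\<Sum>t\<in>A. c t * psum (f t) s ts)"
  by (induction ts arbitrary: s) (auto simp: sum.distrib algebra_simps)

lemma psum_shift: "psum (\<lambda>n. f (n + t)) s ts = psum f (s + t) ts"
  by (induction ts arbitrary: s) (auto simp: add_ac)

lemma energy_diff: "energy (\<lambda>n. f n - g n) ts = energy f ts - energy g ts"
  by (induction ts) (auto simp: psum_diff)

lemma tail_split:
  assumes "summable (\<lambda>n. \<bar>f (Suc n)\<bar>)"
  shows "tail f s = (\<Sum>k<t. \<bar>f (k + Suc s)\<bar>) + tail f (s + t)"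
proof -
  have "summable (\<lambda>k. \<bar>f (k + Suc s)\<bar>)"
    using summable_ignore_initial_segment[OF assms, of s] by simp
  from suminf_split_initial_segment[OF this, of t] show ?thesis
    by (simp add: tail_def add_ac)
qed

lemma tail_nonneg: "summable (\<lambda>n. \<bar>f (Suc n)\<bar>) \<Longrightarrow> 0 \<le> tail f s"
  using summable_ignore_initial_segment[of "\<lambda>n. \<bar>f (Suc n)\<bar>" s]
  by (auto simp: tail_def intro!: suminf_nonneg)

lemma tail_antimono:
  assumes "summable (\<lambda>n. \<bar>f (Suc n)\<bar>)" "s \<le> s'"
  shows "tail f s' \<le> tail f s"
  using tail_split[OF assms(1), of s "s' - s"] assms(2)
  by (simp add: sum_nonneg)

lemma tail_tendsto_0:
  assumes "summable (\<lambda>n. \<bar>f (Suc n)\<bar>)"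
  shows "tail f \<longlonglongrightarrow> 0"
proof -
  have "tail f = (\<lambda>s. (\<Sum>k. \<bar>f (Suc k)\<bar>) - (\<Sum>k<s. \<bar>f (Suc k)\<bar>))"
    using tail_split[OF assms, of 0] by (auto simp: tail_def fun_eq_iff eq_diff_eq add.commute)
  moreover have "(\<lambda>s. (\<Sum>k. \<bar>f (Suc k)\<bar>) - (\<Sum>k<s. \<bar>f (Suc k)\<bar>)) \<longlonglongrightarrow>
      (\<Sum>k. \<bar>f (Suc k)\<bar>) - (\<Sum>k. \<bar>f (Suc k)\<bar>)"
    by (intro tendsto_intros summable_LIMSEQ assms)
  ultimately show ?thesis by simp
qed

(* The partial sums of a list of positive entries are distinct. *)
lemma abs_psum_le_tail:
  assumes "summable (\<lambda>n. \<bar>f (Suc n)\<bar>)" "0 \<notin> set ts"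
  shows "\<bar>psum f s ts\<bar> \<le> tail f s"
  using assms(2)
proof (induction ts arbitrary: s)
  case Nil
  then show ?case using tail_nonneg[OF assms(1)] by simp
next
  case (Cons t ts)
  then have t: "t \<ge> 1" by auto
  have "\<bar>f (s + t)\<bar> \<le> (\<Sum>k<t. \<bar>f (k + Suc s)\<bar>)"
    using member_le_sum[of "t - 1" "{..<t}" "\<lambda>k. \<bar>f (k + Suc s)\<bar>"] t
    by (simp add: add.commute)
  with Cons.IH[of "s + t"] Cons.prems tail_split[OF assms(1), of s t]
  show ?case by auto
qed

text \<open>Each contact sees its successors at distinct positive distances and so contributes at
  most \<open>tail f 0\<close>.\<close>

lemma abs_energy_le:
  assumes "summable (\<lambda>n. \<bar>f (Suc n)\<bar>)" "0 \<notin> set ts"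
  shows "\<bar>energy f ts\<bar> \<le> real (length ts) * tail f 0"
  using assms(2)
proof (induction ts)
  case (Cons t ts)
  then show ?case using abs_psum_le_tail[OF assms(1), of ts 0] by (auto simp: algebra_simps)
qed simp

text \<open>A contact of \<open>ts\<close> that is followed by a further gaps of \<open>ts\<close>
  has distance at least a from the junction, so its interaction with \<open>us\<close> is at most
  \<open>tail f a\<close>. Summed over the contacts this need not stay bounded, but by Cesaro
  averaging it is of smaller order than the length.\<close>

lemma energy_append_ge:
  assumes "summable (\<lambda>n. \<bar>f (Suc n)\<bar>)" "0 \<notin> set ts" "0 \<notin> set us"
  shows "energy f (ts @ us) \<ge> energy f ts + energy f us - (\<Sum>a<length ts. tail f a)"
  using assms(2)
proof (induction ts)
  case (Cons t ts)
  have "\<bar>psum f (sum_list ts) us\<bar> \<le> tail f (length ts)"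
    using abs_psum_le_tail[OF assms(1,3), of "sum_list ts"]
      tail_antimono[OF assms(1) length_le_sum_list[of ts]] Cons.prems by auto
  with Cons show ?case by (auto simp: psum_append)
qed simp

lemma summable_finite_support: "(\<And>s. s > N \<Longrightarrow> f s = 0) \<Longrightarrow> summable (\<lambda>n. \<bar>f (Suc n)\<bar> :: real)"
  by (rule summable_finite[of "{..N}"]) auto

section \<open>Exponential inequalities and limits of real sequences\<close>

lemma exp_le_quadratic:
  fixes x :: real
  assumes "\<bar>x\<bar> \<le> 1"
  shows "exp x \<le> 1 + x + x\<^sup>2"
proof (cases "x \<ge> 0")
  case True
  then show ?thesis using exp_bound[of x] assms by simp
next
  case False
  define y where "y = - x"
  have y: "y \<ge> 0" using False by (simp add: y_def)
  have pos: "1 - y + y\<^sup>2 \<ge> 0" using assms by (simp add: y_def)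
  \<comment> \<open>For x = - y it suffices that (1 - y + y^2) exp y >= 1. With the quadratic Taylor
    polynomial in place of exp y, the product is 1 plus nonnegative terms.\<close>
  have "1 \<le> 1 + y\<^sup>2 / 2 + y ^ 3 / 2 + y ^ 4 / 2" using y by simp
  also have "\<dots> = (1 - y + y\<^sup>2) * (1 + y + y\<^sup>2 / 2)"
    by (simp add: field_simps power2_eq_square power3_eq_cube power4_eq_xxxx)
  also have "\<dots> \<le> (1 - y + y\<^sup>2) * exp y"
    using exp_lower_Taylor_quadratic[OF y] pos by (intro mult_left_mono)
  finally have "exp (- y) * 1 \<le> exp (- y) * ((1 - y + y\<^sup>2) * exp y)"
    by (intro mult_left_mono) auto
  also have "\<dots> = 1 - y + y\<^sup>2" by (simp add: mult.left_commute exp_add[symmetric])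
  finally show ?thesis by (simp add: y_def)
qed

lemma exp_convex_mid: "2 * exp ((x + y) / 2) \<le> exp x + exp (y :: real)"
proof -
  have "0 \<le> (exp (x / 2) - exp (y / 2))\<^sup>2" by simp
  also have "\<dots> = exp x + exp y - 2 * exp ((x + y) / 2)"
    by (simp add: power2_diff exp_double[symmetric] add_divide_distrib exp_add mult.assoc)
  finally show ?thesis by simp
qed

text \<open>Fekete's argument with the error charged to the left block alone. With
  \<open>y n = (a n - g n) / n\<close>, peeling off blocks of length n gives
  \<open>a N / N >= y n - D / N\<close>, while \<open>a N / N = y N + g N / N\<close> is at most the
  supremum of y plus o(1). The limit is this supremum.\<close>

lemma almost_superadditive_limit:
  fixes a g :: "nat \<Rightarrow> real"
  assumes super: "\<And>n m. n \<ge> 1 \<Longrightarrow> m \<ge> 1 \<Longrightarrow> a (n + m) \<ge> a n + a m - g n"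
    and g0: "\<And>n. g n \<ge> 0" and g: "(\<lambda>n. g n / real n) \<longlonglongrightarrow> 0"
    and bound: "\<And>n. n \<ge> 1 \<Longrightarrow> a n \<le> c * real n"
  shows "convergent (\<lambda>n. a n / real n)"
proof -
  define y where "y n = (a n - g n) / real n" for n
  have yc: "y n \<le> c" if "n \<ge> 1" for n
    using bound[OF that] g0[of n] that by (simp add: y_def field_simps)
  define s where "s = (SUP n\<in>{1..}. y n)"
  have bdd: "bdd_above (y ` {1..})" using yc by (auto simp: bdd_above_def)
  have ys: "y n \<le> s" if "n \<ge> 1" for n
    unfolding s_def using bdd that by (intro cSUP_upper) auto
  have "(\<lambda>n. a n / real n) \<longlonglongrightarrow> s"
  proof (rule LIMSEQ_I)
    fix e :: real assume e: "e > 0"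
    have "\<exists>n\<in>{1..}. s - e / 2 < y n"
      using less_cSUP_iff[OF _ bdd, of "s - e / 2"] e by (auto simp: s_def)
    then obtain n where n: "n \<ge> 1" "s - e / 2 < y n" by auto
    define D where "D = (\<Sum>r\<le>n. \<bar>a r\<bar>) + real n * \<bar>y n\<bar>"
    have mult: "a (q * n + r) \<ge> real q * (real n * y n) + a r" if "r \<ge> 1" for q r
    proof (induction q)
      case (Suc q)
      have "a (n + (q * n + r)) \<ge> a n + a (q * n + r) - g n"
        using super[of n "q * n + r"] n that by simp
      moreover have "a n - g n = real n * y n" using n by (simp add: y_def)
      ultimately show ?case using Suc by (simp add: algebra_simps)
    qed simp
    have low: "a N / real N \<ge> y n - D / real N" if N: "N \<ge> 1" for N
    proof -
      \<comment> \<open>The remainder runs from 1 to n instead of 0 to n - 1, since superadditivity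
        is given for blocks of length at least 1.\<close>
      define q r where "q = (N - 1) div n" and "r = (N - 1) mod n + 1"
      have Nq: "N = q * n + r" using N by (simp add: q_def r_def)
      have r: "r \<ge> 1" "r \<le> n" using n by (auto simp: r_def Suc_le_eq)
      have "\<bar>a r\<bar> \<le> (\<Sum>r\<le>n. \<bar>a r\<bar>)" using r by (intro member_le_sum) auto
      moreover have "real r * y n \<le> real n * \<bar>y n\<bar>"
      proof -
        have "real r * y n \<le> real r * \<bar>y n\<bar>" by (intro mult_left_mono) auto
        also have "\<dots> \<le> real n * \<bar>y n\<bar>" using r by (intro mult_right_mono) auto
        finally show ?thesis .
      qed
      ultimately have "a N \<ge> real N * y n - D"
        using mult[OF r(1), of q] Nq by (auto simp: D_def algebra_simps)
      then have "(real N * y n - D) / real N \<le> a N / real N"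
        by (intro divide_right_mono) auto
      then show ?thesis using N by (simp add: diff_divide_distrib)
    qed
    have "(\<lambda>N. D / real N) \<longlonglongrightarrow> 0" by (intro lim_const_over_n)
    then have "\<forall>\<^sub>F N in sequentially. D / real N < e / 2"
      using e by (intro order_tendstoD) auto
    moreover have "\<forall>\<^sub>F N in sequentially. g N / real N < e"
      using g e by (intro order_tendstoD) auto
    moreover have "\<forall>\<^sub>F N in sequentially. N \<ge> (1::nat)"
      by (rule eventually_ge_at_top)
    ultimately have "\<forall>\<^sub>F N in sequentially. norm (a N / real N - s) < e"
    proof eventually_elim
      case (elim N)
      have "a N / real N = y N + g N / real N" by (simp add: y_def diff_divide_distrib)
      then have "a N / real N < s + e" using ys[of N] elim by simp
      moreover have "a N / real N > s - e" using low[of N] n elim by simp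
      ultimately show ?case by (simp add: abs_less_iff)
    qed
    then show "\<exists>no. \<forall>n\<ge>no. norm (a n / real n - s) < e"
      by (simp add: eventually_sequentially)
  qed
  then show ?thesis by (auto simp: convergent_def)
qed

lemma tendsto_average_0:
  fixes f :: "nat \<Rightarrow> real"
  assumes "f \<longlonglongrightarrow> 0" "\<And>n. f n \<ge> 0"
  shows "(\<lambda>n. (\<Sum>a<n. f a) / real n) \<longlonglongrightarrow> 0"
proof (rule LIMSEQ_I)
  fix e :: real assume e: "e > 0"
  have "\<forall>\<^sub>F n in sequentially. f n < e / 2" using assms(1) e by (intro order_tendstoD) auto
  then obtain A where A: "\<And>n. n \<ge> A \<Longrightarrow> f n < e / 2" by (auto simp: eventually_sequentially)
  define D where "D = (\<Sum>a<A. f a)"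
  have le: "(\<Sum>a<n. f a) \<le> D + real n * (e / 2)" for n
  proof (induction n)
    case (Suc n)
    show ?case
    proof (cases "n \<ge> A")
      case True
      then show ?thesis using Suc A[of n] by (simp add: field_simps)
    next
      case False
      then have "(\<Sum>a<Suc n. f a) \<le> D" unfolding D_def
        using assms(2) by (intro sum_mono2) auto
      then show ?thesis using e by (simp add: add_increasing2)
    qed
  qed (auto simp: D_def assms(2) sum_nonneg)
  have "(\<lambda>N. D / real N) \<longlonglongrightarrow> 0" by (intro lim_const_over_n)
  then have "\<forall>\<^sub>F N in sequentially. D / real N < e / 2"
    using e by (intro order_tendstoD) auto
  moreover have "\<forall>\<^sub>F N in sequentially. N \<ge> (1::nat)" by (rule eventually_ge_at_top)
  ultimately have "\<forall>\<^sub>F N in sequentially. norm ((\<Sum>a<N. f a) / real N - 0) < e"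
  proof eventually_elim
    case (elim N)
    have "(\<Sum>a<N. f a) / real N \<le> D / real N + e / 2"
      using le[of N] elim by (simp add: field_simps)
    moreover have "(\<Sum>a<N. f a) / real N \<ge> 0" by (simp add: assms(2) sum_nonneg)
    ultimately show ?case using elim by (simp only: real_norm_def diff_0_right)
  qed
  then show "\<exists>no. \<forall>n\<ge>no. norm ((\<Sum>a<n. f a) / real n - 0) < e"
    by (simp add: eventually_sequentially)
qed

section \<open>Renewal sequences and annealed partition functions\<close>

locale renewal =
  fixes K :: "nat \<Rightarrow> real"
  assumes K_pos: "\<And>n. n \<ge> 1 \<Longrightarrow> K n > 0"
    and K_sums: "(\<lambda>n. K (Suc n)) sums 1"
begin

definition weight :: "nat list \<Rightarrow> real" where
  "weight ts = prod_list (map K ts)"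

text \<open>This is P(n in tau), as \<open>prob_renewal\<close> confirms once a probability space is
  present; the estimates need only its recursion.\<close>

definition renewal_mass :: "nat \<Rightarrow> real" where
  "renewal_mass n = (\<Sum>ts\<in>compositions n. weight ts)"

lemma weight_simps [simp]: "weight [] = 1" "weight (t # ts) = K t * weight ts"
  by (simp_all add: weight_def)

lemma weight_append: "weight (ts @ us) = weight ts * weight us"
  by (simp add: weight_def)

lemma weight_pos: "0 \<notin> set ts \<Longrightarrow> weight ts > 0"
  by (induction ts) (auto intro!: mult_pos_pos K_pos simp: Suc_le_eq)

lemma weight_pos_compositions: "ts \<in> compositions n \<Longrightarrow> weight ts > 0"
  by (auto simp: compositions_def weight_pos)

lemma weight_pos_words: "ts \<in> words R m \<Longrightarrow> weight ts > 0"
  by (intro weight_pos) (auto simp: words_def)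

lemma sum_K_eq: "(\<Sum>t=1..R. K t) = (\<Sum>n<R. K (Suc n))"
  using sum.shift_bounds_Suc_ivl[of K 0 R] by (simp add: atLeastLessThanSuc_atLeastAtMost lessThan_atLeast0)

lemma sum_K_le_1: "(\<Sum>t=1..R. K t) \<le> 1"
proof -
  have "(\<Sum>n<R. K (Suc n)) \<le> (\<Sum>n. K (Suc n))"
    using K_sums K_pos[of "Suc _"] by (intro sum_le_suminf) (auto simp: sums_iff less_imp_le)
  then show ?thesis using K_sums by (simp only: sum_K_eq sums_iff)
qed

lemma sum_K_tendsto_1: "(\<lambda>R. \<Sum>t=1..R. K t) \<longlonglongrightarrow> 1"
  unfolding sum_K_eq using K_sums by (simp add: sums_def)

lemma renewal_mass_0 [simp]: "renewal_mass 0 = 1"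
  by (simp add: renewal_mass_def compositions_0)

lemma renewal_mass_rec: "n \<ge> 1 \<Longrightarrow> renewal_mass n = (\<Sum>t=1..n. K t * renewal_mass (n - t))"
  unfolding renewal_mass_def by (subst sum_compositions_rec) (auto simp: sum_distrib_left)

lemma renewal_mass_nonneg: "renewal_mass n \<ge> 0"
  unfolding renewal_mass_def by (intro sum_nonneg less_imp_le[OF weight_pos_compositions])

lemma renewal_mass_le_1: "renewal_mass n \<le> 1"
proof (induction n rule: less_induct)
  case (less n)
  show ?case
  proof (cases "n = 0")
    case False
    then have n: "n \<ge> 1" by simp
    have "renewal_mass n \<le> (\<Sum>t=1..n. K t * 1)"
      unfolding renewal_mass_rec[OF n]
      using less by (intro sum_mono mult_left_mono) (auto intro: less_imp_le[OF K_pos])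
    then show ?thesis using sum_K_le_1[of n] by simp
  qed simp
qed

end

locale pinning = renewal +
  fixes \<rho> :: "nat \<Rightarrow> real"
  assumes \<rho>_summable: "summable (\<lambda>n. \<bar>\<rho> (Suc n)\<bar>)"
begin

definition Z :: "real \<Rightarrow> real \<Rightarrow> nat \<Rightarrow> real" where
  "Z H b n = (\<Sum>ts\<in>compositions n. weight ts * exp (H * length ts + b * energy \<rho> ts))"

definition \<kappa> :: real where
  "\<kappa> = (\<Sum>n. \<rho> (Suc n) * renewal_mass (Suc n))"

text \<open>The path with the single gap n has one contact and no pair, hence no
  interaction.\<close>

lemma Z_ge_single: 
  assumes "n \<ge> 1"
  shows "Z H b n \<ge> K n * exp H"
proof -
  have "weight [n] * exp (H * length [n] + b * energy \<rho> [n]) \<le> Z H b n"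
    unfolding Z_def using assms
    by (intro member_le_sum finite_compositions)
       (auto simp: compositions_def intro!: mult_nonneg_nonneg less_imp_le[OF weight_pos])
  then show ?thesis by simp
qed

lemma Z_pos: "n \<ge> 1 \<Longrightarrow> Z H b n > 0"
  using Z_ge_single[of n H b] K_pos[of n] by (meson exp_gt_zero less_le_trans mult_pos_pos)

lemma Z_mono: "H \<le> H' \<Longrightarrow> Z H b n \<le> Z H' b n"
  unfolding Z_def
  by (intro sum_mono mult_left_mono less_imp_le[OF weight_pos_compositions])
     (auto intro: mult_right_mono)

lemma Z_le:
  assumes "b \<ge> 0"
  shows "Z H b n \<le> exp ((\<bar>H\<bar> + b * tail \<rho> 0) * n)"
proof -
  have "Z H b n \<le> (\<Sum>ts\<in>compositions n. weight ts * exp ((\<bar>H\<bar> + b * tail \<rho> 0) * n))"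
    unfolding Z_def
  proof (rule sum_mono)
    fix ts assume ts: "ts \<in> compositions n"
    then have ts': "0 \<notin> set ts" and len: "real (length ts) \<le> real n"
      using length_le_sum_list[of ts] by (auto simp: compositions_def)
    have "b * energy \<rho> ts \<le> b * (real (length ts) * tail \<rho> 0)"
      using abs_energy_le[OF \<rho>_summable ts'] assms by (intro mult_left_mono) auto
    moreover have "H * real (length ts) \<le> \<bar>H\<bar> * real (length ts)"
      by (intro mult_right_mono) auto
    ultimately have "H * length ts + b * energy \<rho> ts \<le> (\<bar>H\<bar> + b * tail \<rho> 0) * length ts"
      by (simp add: algebra_simps)
    also have "\<dots> \<le> (\<bar>H\<bar> + b * tail \<rho> 0) * n"
      using len tail_nonneg[OF \<rho>_summable] assms by (intro mult_left_mono) auto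
    finally show "weight ts * exp (H * length ts + b * energy \<rho> ts)
        \<le> weight ts * exp ((\<bar>H\<bar> + b * tail \<rho> 0) * n)"
      using weight_pos_compositions[OF ts] by simp
  qed
  also have "\<dots> = renewal_mass n * exp ((\<bar>H\<bar> + b * tail \<rho> 0) * n)"
    by (simp add: renewal_mass_def sum_distrib_right)
  also have "\<dots> \<le> exp ((\<bar>H\<bar> + b * tail \<rho> 0) * n)"
    using renewal_mass_le_1[of n] by (simp add: mult_le_cancel_right1)
  finally show ?thesis .
qed

text \<open>Keep only the paths of length n + m that visit n. Concatenation is injective because
  gaps are positive, and \<open>energy_append_ge\<close> bounds the interaction across n; a path of
  length n has at most n contacts.\<close>

lemma Z_almost_supermultiplicative:
  assumes "b \<ge> 0"
  shows "Z H b (n + m) \<ge> Z H b n * Z H b m * exp (- b * (\<Sum>a<n. tail \<rho> a))"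
proof -
  let ?g = "\<lambda>ts. weight ts * exp (H * length ts + b * energy \<rho> ts)"
  let ?C = "compositions n \<times> compositions m"
  let ?app = "\<lambda>(ts, us). ts @ us"
  have inj: "inj_on ?app ?C"
  proof (rule inj_onI, clarify)
    fix ts us ts' us'
    assume *: "ts \<in> compositions n" "ts' \<in> compositions n" "ts @ us = ts' @ us'"
    have prefix: "xs @ vs = xs" if "xs @ vs \<in> compositions n" "xs \<in> compositions n" for xs vs
      using that by (cases vs) (simp_all add: compositions_def)
    from *(3) consider vs where "ts = ts' @ vs" | vs where "ts' = ts @ vs"
      unfolding append_eq_append_conv2 by blast
    then have "ts = ts'"
    proof cases
      case 1
      then show ?thesis using prefix[of ts'] *(1,2) by simp
    next
      case 2
      then show ?thesis using prefix[of ts] *(1,2) by simp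
    qed
    then show "ts = ts' \<and> us = us'" using *(3) by simp
  qed
  have "Z H b n * Z H b m = (\<Sum>x\<in>?C. ?g (fst x) * ?g (snd x))"
    by (simp only: Z_def sum_product sum.cartesian_product case_prod_unfold)
  then have "Z H b n * Z H b m * exp (- b * (\<Sum>a<n. tail \<rho> a)) =
        (\<Sum>x\<in>?C. ?g (fst x) * ?g (snd x) * exp (- b * (\<Sum>a<n. tail \<rho> a)))"
    by (simp only: sum_distrib_right)
  also have "\<dots> \<le> (\<Sum>x\<in>?C. ?g (?app x))"
  proof (rule sum_mono)
    fix x assume "x \<in> ?C"
    then obtain ts us where x: "x = (ts, us)" and ts: "ts \<in> compositions n" "us \<in> compositions m"
      by auto
    then have *: "0 \<notin> set ts" "0 \<notin> set us" "length ts \<le> n"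
      using length_le_sum_list[of ts] by (auto simp: compositions_def)
    have "(\<Sum>a<length ts. tail \<rho> a) \<le> (\<Sum>a<n. tail \<rho> a)"
      using * by (intro sum_mono2) (auto intro: tail_nonneg[OF \<rho>_summable])
    with energy_append_ge[OF \<rho>_summable *(1,2)]
    have "energy \<rho> ts + energy \<rho> us - (\<Sum>a<n. tail \<rho> a) \<le> energy \<rho> (ts @ us)" by simp
    from mult_left_mono[OF this assms]
    have "exp (H * length ts + b * energy \<rho> ts) * exp (H * length us + b * energy \<rho> us) *
        exp (- b * (\<Sum>a<n. tail \<rho> a)) \<le> exp (H * length (ts @ us) + b * energy \<rho> (ts @ us))"
      unfolding exp_add[symmetric] exp_le_cancel_iff length_append of_nat_add distrib_left
        right_diff_distrib by linarith
    from mult_left_mono[OF this, of "weight ts * weight us"]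
    show "?g (fst x) * ?g (snd x) * exp (- b * (\<Sum>a<n. tail \<rho> a)) \<le> ?g (?app x)"
      using weight_pos_compositions[OF ts(1)] weight_pos_compositions[OF ts(2)]
      by (simp add: x weight_append mult_ac)
  qed
  also have "\<dots> = (\<Sum>ts\<in>?app ` ?C. ?g ts)"
    using inj by (subst sum.reindex) (auto simp: o_def)
  also have "\<dots> \<le> Z H b (n + m)"
    unfolding Z_def
    by (intro sum_mono2 finite_compositions)
       (auto simp: compositions_def intro!: mult_nonneg_nonneg less_imp_le[OF weight_pos])
  finally show ?thesis .
qed

text \<open>The error \<open>b * (\<Sum>a<n. tail \<rho> a)\<close> is o(n) as a Cesaro sum of a
  null sequence. Convergence makes the \<open>lim\<close> that defines the free energy a genuine
  limit.\<close>

lemma free_energy_convergent: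
  assumes "b \<ge> 0"
  shows "convergent (\<lambda>n. ln (Z H b n) / real n)"
proof (rule almost_superadditive_limit)
  fix n m :: nat assume nm: "n \<ge> 1" "m \<ge> 1"
  have "ln (Z H b (n + m)) \<ge> ln (Z H b n * Z H b m * exp (- b * (\<Sum>a<n. tail \<rho> a)))"
    using nm Z_pos Z_almost_supermultiplicative[OF assms] by (subst ln_le_cancel_iff) auto
  also have "ln (Z H b n * Z H b m * exp (- b * (\<Sum>a<n. tail \<rho> a))) =
      ln (Z H b n) + ln (Z H b m) - b * (\<Sum>a<n. tail \<rho> a)"
    using Z_pos[of n H b] Z_pos[of m H b] nm by (simp add: ln_mult)
  finally show "ln (Z H b (n + m)) \<ge> ln (Z H b n) + ln (Z H b m) - b * (\<Sum>a<n. tail \<rho> a)" .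
next
  show "b * (\<Sum>a<n. tail \<rho> a) \<ge> 0" for n
    using assms by (intro mult_nonneg_nonneg sum_nonneg tail_nonneg[OF \<rho>_summable])
  have "(\<lambda>n. b * ((\<Sum>a<n. tail \<rho> a) / real n)) \<longlonglongrightarrow> b * 0"
    by (intro tendsto_mult tendsto_const tendsto_average_0 tail_tendsto_0 tail_nonneg \<rho>_summable)
  then show "(\<lambda>n. b * (\<Sum>a<n. tail \<rho> a) / real n) \<longlonglongrightarrow> 0" by simp
  show "ln (Z H b n) \<le> (\<bar>H\<bar> + b * tail \<rho> 0) * real n" if "n \<ge> 1" for n
    using ln_mono[OF Z_le[OF assms] Z_pos[OF that], of H] by simp
qed

definition free_energy :: "real \<Rightarrow> real \<Rightarrow> real" where
  "free_energy H b = lim (\<lambda>n. ln (Z H b n) / real n)"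

lemma free_energy_LIMSEQ: "b \<ge> 0 \<Longrightarrow> (\<lambda>n. ln (Z H b n) / real n) \<longlonglongrightarrow> free_energy H b"
  unfolding free_energy_def using free_energy_convergent convergent_LIMSEQ_iff by blast

lemma free_energy_mono:
  assumes "b \<ge> 0" "H \<le> H'"
  shows "free_energy H b \<le> free_energy H' b"
proof (rule LIMSEQ_le[OF free_energy_LIMSEQ[OF assms(1)] free_energy_LIMSEQ[OF assms(1)]],
    intro exI allI impI)
  fix n :: nat assume "n \<ge> 1"
  then show "ln (Z H b n) / real n \<le> ln (Z H' b n) / real n"
    using Z_mono[OF assms(2), of b n] Z_pos[of n H b] by (intro divide_right_mono ln_mono) auto
qed

subsection \<open>The corrector\<close>

text \<open>The value 0 at n = 0 makes \<open>potential_kernel\<close> at s = 0 return exactly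
  \<open>potential N 0\<close>, the drift per gap, and makes that number a partial sum of the series
  for \<kappa>.\<close>

definition range_cut :: "nat \<Rightarrow> nat \<Rightarrow> real" where
  "range_cut N n = (if 1 \<le> n \<and> n \<le> N then \<rho> n else 0)"

(* Potential of the cut-off correlations under the renewal kernel, so that psum (potential N) 0
   is the corrector whose one-step average is computed in poisson_equation. *)
definition potential :: "nat \<Rightarrow> nat \<Rightarrow> real" where
  "potential N s = (\<Sum>n\<le>N. renewal_mass n * range_cut N (n + s))"

lemma potential_eq_0: "s > N \<Longrightarrow> potential N s = 0"
  by (auto simp: potential_def range_cut_def intro!: sum.neutral)

lemma potential_summable: "summable (\<lambda>n. \<bar>potential N (Suc n)\<bar>)"
  by (rule summable_finite_support) (rule potential_eq_0)

text \<open>By the renewal equation, averaging over one more gap t turns the products of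
  \<open>K t\<close> with the mass at n - t into the mass at n for every n >= 1; only the term n =
  0, which is \<open>range_cut N s\<close>, is lost. For R >= N the truncated sum is exact, as the
  potential vanishes beyond N.\<close>

lemma potential_kernel:
  assumes "R \<ge> N"
  shows "(\<Sum>t=1..R. K t * potential N (s + t)) = potential N s - range_cut N s"
proof -
  let ?r = "\<lambda>n. range_cut N (n + s)"
  have r0: "?r n = 0" if "n > N" for n using that by (auto simp: range_cut_def)
  let ?f = "\<lambda>(t, n). K t * renewal_mass n * ?r (n + t)"
  have "(\<Sum>t=1..R. K t * potential N (s + t)) = (\<Sum>x\<in>{1..R} \<times> {..N}. ?f x)"
    by (simp add: potential_def sum_distrib_left sum.cartesian_product case_prod_unfold mult_ac add_ac)
  also have "\<dots> = (\<Sum>x\<in>{x\<in>{1..R} \<times> {..N}. fst x + snd x \<le> N}. ?f x)"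
    by (rule sum.mono_neutral_right) (auto, metis r0 add.commute not_le)
  also have "\<dots> = (\<Sum>(n, t)\<in>(SIGMA n:{1..N}. {1..n}). K t * renewal_mass (n - t) * ?r n)"
    using assms
    by (intro sum.reindex_bij_witness[where i = "\<lambda>(n, t). (t, n - t)" and j = "\<lambda>(t, n). (t + n, t)"])
       (auto simp: add_ac)
  also have "\<dots> = (\<Sum>n=1..N. \<Sum>t=1..n. K t * renewal_mass (n - t) * ?r n)"
    by (simp add: sum.Sigma)
  also have "\<dots> = (\<Sum>n=1..N. renewal_mass n * ?r n)"
    by (intro sum.cong refl) (simp add: renewal_mass_rec sum_distrib_right)
  also have "\<dots> = potential N s - range_cut N s"
  proof -
    have "{..N} = insert 0 {1..N}" by auto
    then show ?thesis by (simp add: potential_def)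
  qed
  finally show ?thesis .
qed

text \<open>Prepending a gap raises the cut-off energy by \<open>psum (range_cut N) 0 ts\<close>,
  whatever its length. The averaged corrector drops by the same amount, so energy plus corrector
  gains the constant \<open>potential N 0\<close>, independent of \<open>ts\<close>.\<close>

lemma poisson_equation:
  assumes "R \<ge> N"
  shows "(\<Sum>t=1..R. K t * psum (potential N) 0 (t # ts)) =
    psum (potential N) 0 ts - psum (range_cut N) 0 ts + potential N 0"
proof -
  have "(\<Sum>t=1..R. K t * psum (potential N) t ts) =
      psum (\<lambda>n. \<Sum>t=1..R. K t * potential N (n + t)) 0 ts"
    by (simp add: psum_sum psum_shift)
  also have "\<dots> = psum (potential N) 0 ts - psum (range_cut N) 0 ts"
    by (simp only: potential_kernel[OF assms] psum_diff)
  finally show ?thesis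
    using potential_kernel[OF assms, of 0]
    by (simp add: algebra_simps sum.distrib range_cut_def)
qed

lemma abs_corrector_le:
  "0 \<notin> set ts \<Longrightarrow> \<bar>psum (potential N) 0 ts\<bar> \<le> tail (potential N) 0"
  by (intro abs_psum_le_tail potential_summable)

definition corrected :: "real \<Rightarrow> nat \<Rightarrow> nat list \<Rightarrow> real" where
  "corrected b N ts = weight ts * exp (b * (energy (range_cut N) ts + psum (potential N) 0 ts))"

lemma corrected_nonneg: "0 \<notin> set ts \<Longrightarrow> corrected b N ts \<ge> 0"
  by (simp add: corrected_def less_imp_le[OF weight_pos])

text \<open>The energy of \<open>t # ts\<close> does not depend on t, so only the corrector is
  averaged. Rewriting the energy increment by the Poisson equation leaves the drift factor and an
  exponential moment of the corrector, centred at its mean under the truncated kernel.\<close>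

lemma sum_corrected_Cons:
  assumes "R \<ge> N"
  shows "(\<Sum>t=1..R. corrected b N (t # ts)) = corrected b N ts * exp (b * potential N 0) *
    ((\<Sum>t=1..R. K t * exp (b * psum (potential N) 0 (t # ts))) *
      exp (- b * (\<Sum>t=1..R. K t * psum (potential N) 0 (t # ts))))"
proof -
  have "(\<Sum>t=1..R. corrected b N (t # ts)) =
    weight ts * exp (b * (energy (range_cut N) ts + psum (range_cut N) 0 ts)) *
      (\<Sum>t=1..R. K t * exp (b * psum (potential N) 0 (t # ts)))"
    by (simp add: corrected_def sum_distrib_left exp_add[symmetric] algebra_simps)
  then show ?thesis
    unfolding poisson_equation[OF assms]
    by (simp add: corrected_def exp_add[symmetric] algebra_simps)
qed

context
  fixes R N :: nat and b :: real and B :: real and ts :: "nat list"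
  assumes R: "R \<ge> N" and b: "b \<ge> 0" and ts: "0 \<notin> set ts"
  defines "B \<equiv> tail (potential N) 0"
begin

lemma abs_corrector_Cons_le: "t \<ge> 1 \<Longrightarrow> \<bar>psum (potential N) 0 (t # ts)\<bar> \<le> B"
  unfolding B_def using ts by (intro abs_corrector_le) auto

text \<open>In the second order bound on exp the linear term is removed by the centring, and
  \<open>(b * B)\<^sup>2\<close> remains. The bound is uniform in R because the kernel has mass at
  most 1.\<close>

lemma sum_corrected_Cons_le:
  assumes small: "b * B \<le> 1"
  shows "(\<Sum>t=1..R. corrected b N (t # ts)) \<le>
    corrected b N ts * exp (b * potential N 0 + (b * B)\<^sup>2)"
proof -
  let ?\<psi> = "\<lambda>t. psum (potential N) 0 (t # ts)"
  let ?\<mu> = "\<Sum>t=1..R. K t * ?\<psi> t"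
  have "(\<Sum>t=1..R. K t * exp (b * ?\<psi> t)) \<le> (\<Sum>t=1..R. K t * (1 + b * ?\<psi> t + (b * B)\<^sup>2))"
  proof (intro sum_mono mult_left_mono)
    fix t assume t: "t \<in> {1..R}"
    then show "0 \<le> K t" by (intro less_imp_le[OF K_pos]) auto
    have le: "\<bar>b * ?\<psi> t\<bar> \<le> b * B"
      using abs_corrector_Cons_le[of t] t b unfolding abs_mult by (simp add: mult_left_mono)
    then have "(b * ?\<psi> t)\<^sup>2 \<le> (b * B)\<^sup>2" by (metis abs_ge_zero order_trans abs_le_square_iff abs_of_nonneg)
    then show "exp (b * ?\<psi> t) \<le> 1 + b * ?\<psi> t + (b * B)\<^sup>2"
      using exp_le_quadratic[of "b * ?\<psi> t"] le small by simp
  qed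
  also have "\<dots> = b * ?\<mu> + (1 + (b * B)\<^sup>2) * (\<Sum>t=1..R. K t)"
    by (simp only: sum_distrib_left sum.distrib[symmetric]) (simp add: algebra_simps)
  also have "\<dots> \<le> b * ?\<mu> + (1 + (b * B)\<^sup>2) * 1"
    using sum_K_le_1[of R] by (intro add_left_mono mult_left_mono) (auto simp: add_nonneg_nonneg)
  also have "\<dots> \<le> exp (b * ?\<mu> + (b * B)\<^sup>2)"
    using exp_ge_add_one_self[of "b * ?\<mu> + (b * B)\<^sup>2"] by (simp only: mult_1_right add_ac)
  finally have "(\<Sum>t=1..R. K t * exp (b * ?\<psi> t)) * exp (- b * ?\<mu>) \<le>
      exp (b * ?\<mu> + (b * B)\<^sup>2) * exp (- b * ?\<mu>)"
    by (intro mult_right_mono) auto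
  also have "\<dots> = exp ((b * B)\<^sup>2)" by (simp add: exp_add[symmetric])
  finally have "corrected b N ts * exp (b * potential N 0) *
      ((\<Sum>t=1..R. K t * exp (b * ?\<psi> t)) * exp (- b * ?\<mu>)) \<le>
      corrected b N ts * exp (b * potential N 0) * exp ((b * B)\<^sup>2)"
    using corrected_nonneg[OF ts] by (intro mult_left_mono) auto
  then show ?thesis unfolding sum_corrected_Cons[OF R] by (simp add: exp_add mult.assoc)
qed

text \<open>With k the truncated mass and \<mu> the mean of the corrector, exp x >= 1 + x applied to
  the centred corrector gives k + b \<mu> (1 - k). The loss thus comes from the missing mass 1 - k
  alone and can be made small through R at fixed b.\<close>

lemma sum_corrected_Cons_ge:
  "(\<Sum>t=1..R. corrected b N (t # ts)) \<ge>
    corrected b N ts * exp (b * potential N 0) * (1 - (1 - (\<Sum>t=1..R. K t)) * (1 + b * B))"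
proof -
  let ?\<psi> = "\<lambda>t. psum (potential N) 0 (t # ts)"
  let ?\<mu> = "\<Sum>t=1..R. K t * ?\<psi> t"
  let ?k = "\<Sum>t=1..R. K t"
  have B0: "B \<ge> 0" using abs_corrector_Cons_le[of 1] by simp
  have "\<bar>?\<mu>\<bar> \<le> (\<Sum>t=1..R. K t * B)"
    using K_pos abs_corrector_Cons_le
    by (intro order_trans[OF sum_abs] sum_mono) (auto simp: abs_mult less_imp_le intro!: mult_mono)
  also have "\<dots> \<le> 1 * B"
    unfolding sum_distrib_right[symmetric] using sum_K_le_1[of R] B0 by (intro mult_right_mono) auto
  finally have \<mu>: "\<bar>?\<mu>\<bar> \<le> B" by simp
  have "b * ?\<mu> * (1 - ?k) \<ge> - (b * B) * (1 - ?k)"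
    using \<mu> b sum_K_le_1[of R] mult_left_mono[of "- B" ?\<mu> b] by (intro mult_right_mono) auto
  then have "1 - (1 - ?k) * (1 + b * B) \<le> ?k + b * ?\<mu> * (1 - ?k)"
    by (simp add: algebra_simps)
  also have "\<dots> = (\<Sum>t=1..R. K t * (1 + (b * ?\<psi> t - b * ?\<mu>)))"
    by (simp add: distrib_left right_diff_distrib sum.distrib sum_subtractf sum_distrib_left[symmetric]
         sum_distrib_right[symmetric] mult.left_commute[of _ b] mult.commute[of ?k] del: psum.simps)
  also have "\<dots> \<le> (\<Sum>t=1..R. K t * exp (b * ?\<psi> t - b * ?\<mu>))"
    using K_pos by (intro sum_mono mult_left_mono exp_ge_add_one_self) (auto simp: less_imp_le)
  also have "\<dots> = (\<Sum>t=1..R. K t * exp (b * ?\<psi> t)) * exp (- b * ?\<mu>)"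
    by (simp add: sum_distrib_right exp_diff exp_minus divide_inverse mult.assoc del: psum.simps)
  finally show ?thesis
    unfolding sum_corrected_Cons[OF R] using corrected_nonneg[OF ts]
    by (intro mult_left_mono) auto
qed

end

lemma words_positive: "ts \<in> words R m \<Longrightarrow> 0 \<notin> set ts"
  by (auto simp: words_def)

lemma sum_words_corrected_le:
  assumes "R \<ge> N" "b \<ge> 0" "b * tail (potential N) 0 \<le> 1"
  shows "(\<Sum>ts\<in>words R m. corrected b N ts) \<le> exp (b * potential N 0 + (b * tail (potential N) 0)\<^sup>2) ^ m"
proof (induction m)
  case 0
  then show ?case by (simp add: words_0 corrected_def)
next
  case (Suc m)
  let ?q = "exp (b * potential N 0 + (b * tail (potential N) 0)\<^sup>2)"
  have "(\<Sum>ts\<in>words R (Suc m). corrected b N ts) \<le> (\<Sum>ts\<in>words R m. corrected b N ts * ?q)"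
    unfolding sum_words_Suc using assms
    by (intro sum_mono sum_corrected_Cons_le words_positive)
  also have "\<dots> \<le> ?q ^ m * ?q"
    unfolding sum_distrib_right[symmetric] using Suc by (intro mult_right_mono) auto
  finally show ?case by (simp add: mult.commute)
qed

lemma sum_words_corrected_ge:
  assumes "R \<ge> N" "b \<ge> 0" "(1 - (\<Sum>t=1..R. K t)) * (1 + b * tail (potential N) 0) \<le> c" "c \<le> 1"
  shows "(\<Sum>ts\<in>words R m. corrected b N ts) \<ge> (exp (b * potential N 0) * (1 - c)) ^ m"
proof (induction m)
  case 0
  then show ?case by (simp add: words_0 corrected_def)
next
  case (Suc m)
  let ?q = "exp (b * potential N 0) * (1 - c)"
  have "?q ^ m * ?q \<le> (\<Sum>ts\<in>words R m. corrected b N ts * ?q)"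
    unfolding sum_distrib_right[symmetric] using Suc assms by (intro mult_right_mono) auto
  also have "\<dots> \<le> (\<Sum>ts\<in>words R (Suc m). corrected b N ts)"
    unfolding sum_words_Suc
  proof (rule sum_mono)
    fix ts assume "ts \<in> words R m"
    then have ts: "0 \<notin> set ts" by (rule words_positive)
    have "corrected b N ts * exp (b * potential N 0) * (1 - c) \<le> corrected b N ts * exp (b * potential N 0) *
        (1 - (1 - (\<Sum>t=1..R. K t)) * (1 + b * tail (potential N) 0))"
      using assms corrected_nonneg[OF ts] by (intro mult_left_mono) auto
    also have "\<dots> \<le> (\<Sum>t=1..R. corrected b N (t # ts))"
      by (rule sum_corrected_Cons_ge[OF assms(1,2) ts])
    finally show "corrected b N ts * ?q \<le> (\<Sum>t=1..R. corrected b N (t # ts))" by (simp add: mult.assoc)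
  qed
  finally show ?case by (simp add: mult.commute)
qed

section \<open>From finite range to summable correlations\<close>

lemma abs_energy_range_cut_le:
  assumes "0 \<notin> set ts"
  shows "\<bar>energy \<rho> ts - energy (range_cut N) ts\<bar> \<le> real (length ts) * tail \<rho> N"
proof -
  let ?f = "\<lambda>n. \<rho> n - range_cut N n"
  have f: "?f n = (if 1 \<le> n \<and> n \<le> N then 0 else \<rho> n)" for n by (simp add: range_cut_def)
  have summ: "summable (\<lambda>n. \<bar>?f (Suc n)\<bar>)"
    by (rule summable_comparison_test[OF _ \<rho>_summable]) (auto simp: f)
  have "tail ?f 0 = (\<Sum>k<N. \<bar>?f (k + Suc 0)\<bar>) + tail ?f N"
    using tail_split[OF summ, of 0 N] by simp
  also have "\<dots> = tail \<rho> N" by (simp add: f tail_def)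
  finally show ?thesis
    using abs_energy_le[OF summ assms] by (simp add: energy_diff)
qed

lemma summable_\<rho>_mass: "summable (\<lambda>n. \<bar>\<rho> (Suc n) * renewal_mass (Suc n)\<bar>)"
  using renewal_mass_le_1 renewal_mass_nonneg
  by (intro summable_comparison_test[OF _ \<rho>_summable])
     (auto simp: abs_mult intro!: mult_left_le exI[of _ 0])

text \<open>\<open>potential N 0\<close> is the N-th partial sum of the series \<kappa>, and the
  renewal masses are at most 1.\<close>

lemma potential_0_approx: "\<bar>\<kappa> - potential N 0\<bar> \<le> tail \<rho> N"
proof -
  let ?a = "\<lambda>n. \<rho> (Suc n) * renewal_mass (Suc n)"
  have "potential N 0 = (\<Sum>n=1..N. renewal_mass n * range_cut N n)"
  proof -
    have "{..N} = insert 0 {1..N}" by auto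
    then show ?thesis by (simp add: potential_def range_cut_def)
  qed
  also have "\<dots> = (\<Sum>n<N. ?a n)"
    by (intro sum.reindex_bij_witness[of _ Suc "\<lambda>n. n - 1"]) (auto simp: range_cut_def mult.commute)
  finally have "\<kappa> - potential N 0 = (\<Sum>n. ?a (n + N))"
    using suminf_split_initial_segment[OF summable_rabs_cancel[OF summable_\<rho>_mass], of N] by (simp add: \<kappa>_def)
  also have "\<bar>\<dots>\<bar> \<le> (\<Sum>n. \<bar>?a (n + N)\<bar>)"
    by (rule summable_rabs[OF summable_ignore_initial_segment[OF summable_\<rho>_mass]])
  also have "\<dots> \<le> (\<Sum>n. \<bar>\<rho> (Suc (n + N))\<bar>)"
    using summable_ignore_initial_segment[OF summable_\<rho>_mass, of N]
      summable_ignore_initial_segment[OF \<rho>_summable, of N] renewal_mass_le_1 renewal_mass_nonneg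
    by (intro suminf_le) (auto simp: abs_mult intro!: mult_left_le)
  also have "\<dots> = tail \<rho> N" by (simp add: tail_def)
  finally show ?thesis .
qed

lemma obtain_range:
  assumes "\<epsilon> > 0"
  obtains N where "tail \<rho> N \<le> \<epsilon>" "\<bar>\<kappa> - potential N 0\<bar> \<le> \<epsilon>"
proof -
  have "\<forall>\<^sub>F N in sequentially. tail \<rho> N < \<epsilon>"
    using tail_tendsto_0[OF \<rho>_summable] assms by (intro order_tendstoD)
  then obtain N where "tail \<rho> N < \<epsilon>" by (auto simp: eventually_sequentially)
  then show ?thesis using potential_0_approx[of N] that[of N] by auto
qed

definition words_partition :: "real \<Rightarrow> nat \<Rightarrow> nat \<Rightarrow> real" where
  "words_partition b R m = (\<Sum>ts\<in>words R m. weight ts * exp (b * energy \<rho> ts))"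

text \<open>Three losses share \<epsilon>: replacing \<kappa> by \<open>potential N 0\<close>,
  cutting the energy, and the quadratic term. Removing the corrector at the end costs exp 1, because
  b times its bound is at most 1.\<close>

lemma words_partition_le:
  assumes "\<epsilon> > 0"
  shows "\<exists>b0>0. \<forall>b. 0 \<le> b \<longrightarrow> b \<le> b0 \<longrightarrow>
    (\<forall>R m. words_partition b R m \<le> exp 1 * exp (b * (\<kappa> + \<epsilon>)) ^ m)"
proof -
  obtain N where N: "tail \<rho> N \<le> \<epsilon> / 3" "\<bar>\<kappa> - potential N 0\<bar> \<le> \<epsilon> / 3"
    using obtain_range[of "\<epsilon> / 3"] assms by auto
  define B where "B = tail (potential N) 0"
  have B: "B \<ge> 0" unfolding B_def by (rule tail_nonneg[OF potential_summable])
  \<comment> \<open>The first entry ensures b B <= 1, the second b B^2 <= \<epsilon> / 3, so that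
    the quadratic term (b B)^2 is at most b \<epsilon> / 3. Neither depends on R or m.\<close>
  define b0 where "b0 = min (1 / (B + 1)) (\<epsilon> / (3 * (B\<^sup>2 + 1)))"
  have "b0 > 0" using B assms by (auto simp: b0_def intro!: divide_pos_pos add_nonneg_pos)
  moreover have "words_partition b R m \<le> exp 1 * exp (b * (\<kappa> + \<epsilon>)) ^ m"
    if b: "0 \<le> b" "b \<le> b0" for b R m
  proof -
    have "b * B \<le> 1 / (B + 1) * B" using b B by (intro mult_right_mono) (auto simp: b0_def)
    also have "\<dots> \<le> 1" using B by (simp add: field_simps)
    finally have bB: "b * B \<le> 1" .
    have "b * B\<^sup>2 \<le> \<epsilon> / (3 * (B\<^sup>2 + 1)) * B\<^sup>2" using b by (intro mult_right_mono) (auto simp: b0_def)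
    also have "\<dots> = \<epsilon> / 3 * (B\<^sup>2 / (B\<^sup>2 + 1))" by simp
    also have "\<dots> \<le> \<epsilon> / 3 * 1"
      using assms by (intro mult_left_mono) (auto simp: divide_le_eq_1 add_nonneg_pos)
    finally have "b * B\<^sup>2 \<le> \<epsilon> / 3" by simp
    then have bB2: "b * (b * B\<^sup>2) \<le> b * (\<epsilon> / 3)" using b by (intro mult_left_mono) auto
    \<comment> \<open>The one-gap estimate is for caps of at least N; raising the cap only adds
      nonnegative terms.\<close>
    define R' where "R' = max R N"
    have "words_partition b R m \<le> words_partition b R' m"
      unfolding words_partition_def
      by (intro sum_mono2 finite_words words_mono)
         (auto simp: R'_def intro!: mult_nonneg_nonneg less_imp_le[OF weight_pos_words])
    also have "\<dots> \<le> (\<Sum>ts\<in>words R' m. corrected b N ts * (exp 1 * exp (b * (\<epsilon> / 3)) ^ m))"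
      unfolding words_partition_def
    proof (rule sum_mono)
      fix ts assume ts: "ts \<in> words R' m"
      then have ts0: "0 \<notin> set ts" and len: "length ts = m" by (auto simp: words_def)
      have "energy \<rho> ts \<le> energy (range_cut N) ts + m * (\<epsilon> / 3)"
        using abs_energy_range_cut_le[OF ts0, of N] N(1) len mult_left_mono[OF N(1), of "real m"] by auto
      then have "b * energy \<rho> ts \<le> b * (energy (range_cut N) ts + m * (\<epsilon> / 3))"
        using b by (intro mult_left_mono) auto
      moreover have "- 1 \<le> b * psum (potential N) 0 ts"
        using abs_corrector_le[OF ts0, of N] bB mult_left_mono[of "- psum (potential N) 0 ts" B b, OF _ b(1)]
        unfolding B_def by linarith
      ultimately have "b * energy \<rho> ts \<le>
          b * (energy (range_cut N) ts + psum (potential N) 0 ts) + (1 + real m * (b * (\<epsilon> / 3)))"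
        by (simp add: algebra_simps)
      then have "weight ts * exp (b * energy \<rho> ts) \<le> weight ts *
          exp (b * (energy (range_cut N) ts + psum (potential N) 0 ts) + (1 + real m * (b * (\<epsilon> / 3))))"
        using weight_pos[OF ts0] by (intro mult_left_mono) auto
      also have "\<dots> = corrected b N ts * (exp 1 * exp (b * (\<epsilon> / 3)) ^ m)"
        by (simp add: corrected_def exp_add exp_of_nat_mult[symmetric] mult_ac)
      finally show "weight ts * exp (b * energy \<rho> ts) \<le> corrected b N ts * (exp 1 * exp (b * (\<epsilon> / 3)) ^ m)" .
    qed
    also have "\<dots> \<le> exp (b * potential N 0 + (b * B)\<^sup>2) ^ m * (exp 1 * exp (b * (\<epsilon> / 3)) ^ m)"
      unfolding sum_distrib_right[symmetric] B_def
      using b bB by (intro mult_right_mono sum_words_corrected_le) (auto simp: R'_def B_def)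
    also have "\<dots> = exp 1 * exp (b * potential N 0 + (b * B)\<^sup>2 + b * (\<epsilon> / 3)) ^ m"
      by (simp add: exp_add power_mult_distrib mult_ac)
    also have "\<dots> \<le> exp 1 * exp (b * (\<kappa> + \<epsilon>)) ^ m"
    proof -
      have "b * potential N 0 \<le> b * (\<kappa> + \<epsilon> / 3)" using N(2) b by (intro mult_left_mono; linarith)
      then have "b * potential N 0 + (b * B)\<^sup>2 + b * (\<epsilon> / 3) \<le> b * (\<kappa> + \<epsilon>)"
        using bB2 by (simp add: algebra_simps power2_eq_square)
      then show ?thesis by (intro mult_left_mono power_mono) auto
    qed
    finally show ?thesis .
  qed
  ultimately show ?thesis by blast
qed

text \<open>Here b is fixed first and R chosen afterwards, so the mass lost beyond R can be pushed
  below order b. The constant C = exp (- b B) pays for removing the corrector.\<close>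

lemma words_partition_ge:
  assumes "\<epsilon> > 0" "b > 0"
  shows "\<exists>R. \<exists>C>0. \<forall>m. words_partition b R m \<ge> C * exp (b * (\<kappa> - \<epsilon>)) ^ m"
proof -
  obtain N where N: "tail \<rho> N \<le> \<epsilon> / 3" "\<bar>\<kappa> - potential N 0\<bar> \<le> \<epsilon> / 3"
    using obtain_range[of "\<epsilon> / 3"] assms by auto
  define B where "B = tail (potential N) 0"
  have B: "B \<ge> 0" unfolding B_def by (rule tail_nonneg[OF potential_summable])
  \<comment> \<open>Chosen so that 1 - c = exp (- b \<epsilon> / 3): the mass cut off at R consumes
    the third share of \<epsilon>.\<close>
  define c where "c = 1 - exp (- b * (\<epsilon> / 3))"
  have c: "0 < c" "c \<le> 1" using assms by (auto simp: c_def)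
  have "(\<lambda>R. (1 - (\<Sum>t=1..R. K t)) * (1 + b * B)) \<longlonglongrightarrow> (1 - 1) * (1 + b * B)"
    by (intro tendsto_intros sum_K_tendsto_1)
  then have "\<forall>\<^sub>F R in sequentially. (1 - (\<Sum>t=1..R. K t)) * (1 + b * B) < c"
    using c by (intro order_tendstoD) auto
  moreover have "\<forall>\<^sub>F R in sequentially. R \<ge> N" by (rule eventually_ge_at_top)
  ultimately have "\<forall>\<^sub>F R in sequentially. (1 - (\<Sum>t=1..R. K t)) * (1 + b * B) < c \<and> R \<ge> N"
    by eventually_elim auto
  then obtain R where R: "R \<ge> N" "(1 - (\<Sum>t=1..R. K t)) * (1 + b * B) < c"
    by (auto simp: eventually_sequentially)
  have "words_partition b R m \<ge> exp (- b * B) * exp (b * (\<kappa> - \<epsilon>)) ^ m" for m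
  proof -
    have "b * (\<kappa> - \<epsilon> / 3) \<le> b * potential N 0" using N(2) assms by (intro mult_left_mono; linarith)
    then have "exp (b * (\<kappa> - \<epsilon>)) \<le> exp (b * potential N 0 - b * (\<epsilon> / 3) - b * (\<epsilon> / 3))"
      by (simp add: algebra_simps)
    also have "\<dots> = exp (b * potential N 0) * (1 - c) * exp (- b * (\<epsilon> / 3))"
      by (simp add: c_def exp_add[symmetric])
    finally have "exp (b * (\<kappa> - \<epsilon>)) ^ m \<le> (exp (b * potential N 0) * (1 - c) * exp (- b * (\<epsilon> / 3))) ^ m"
      by (intro power_mono) auto
    also have "\<dots> \<le> (\<Sum>ts\<in>words R m. corrected b N ts) * exp (- b * (\<epsilon> / 3)) ^ m"
      unfolding power_mult_distrib[of "_ * _"] using R assms c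
      by (intro mult_right_mono sum_words_corrected_ge) (auto simp: B_def)
    finally have "exp (- b * B) * exp (b * (\<kappa> - \<epsilon>)) ^ m \<le>
        exp (- b * B) * ((\<Sum>ts\<in>words R m. corrected b N ts) * exp (- b * (\<epsilon> / 3)) ^ m)"
      by (intro mult_left_mono) auto
    also have "\<dots> = (\<Sum>ts\<in>words R m. corrected b N ts * (exp (- b * B) * exp (- b * (\<epsilon> / 3)) ^ m))"
      by (simp add: sum_distrib_right[symmetric])
    also have "\<dots> \<le> words_partition b R m"
      unfolding words_partition_def
    proof (rule sum_mono)
      fix ts assume ts: "ts \<in> words R m"
      then have ts0: "0 \<notin> set ts" and len: "length ts = m" by (auto simp: words_def)
      have "energy \<rho> ts \<ge> energy (range_cut N) ts - m * (\<epsilon> / 3)"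
        using abs_energy_range_cut_le[OF ts0, of N] N(1) len mult_left_mono[OF N(1), of "real m"] by auto
      then have "b * energy \<rho> ts \<ge> b * (energy (range_cut N) ts - m * (\<epsilon> / 3))"
        using assms by (intro mult_left_mono) auto
      moreover have "b * B \<ge> b * psum (potential N) 0 ts"
        using abs_corrector_le[OF ts0, of N] assms by (intro mult_left_mono) (auto simp: B_def)
      ultimately have "b * energy \<rho> ts \<ge>
          b * (energy (range_cut N) ts + psum (potential N) 0 ts) + (- b * B + real m * (- b * (\<epsilon> / 3)))"
        by (simp add: algebra_simps)
      then have "weight ts * exp (b * energy \<rho> ts) \<ge> weight ts *
          exp (b * (energy (range_cut N) ts + psum (potential N) 0 ts) + (- b * B + real m * (- b * (\<epsilon> / 3))))"
        using weight_pos[OF ts0] by (intro mult_left_mono) auto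
      also have "weight ts * exp (b * (energy (range_cut N) ts + psum (potential N) 0 ts) +
          (- b * B + real m * (- b * (\<epsilon> / 3)))) = corrected b N ts * (exp (- b * B) * exp (- b * (\<epsilon> / 3)) ^ m)"
        unfolding exp_add exp_of_nat_mult by (simp add: corrected_def mult_ac exp_add)
      finally show "corrected b N ts * (exp (- b * B) * exp (- b * (\<epsilon> / 3)) ^ m) \<le> weight ts * exp (b * energy \<rho> ts)" .
    qed
    finally show ?thesis .
  qed
  then show ?thesis by (intro exI[of _ R] exI[of _ "exp (- b * B)"]) auto
qed

subsection \<open>The sign of the free energy\<close>

lemma sum_words_eq_words_partition:
  fixes H :: real
  shows "(\<Sum>ts\<in>words R m. weight ts * exp (H * length ts + b * energy \<rho> ts)) = exp H ^ m * words_partition b R m"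
  unfolding words_partition_def sum_distrib_left
  by (intro sum.cong refl) (simp add: words_def exp_add exp_of_nat_mult[symmetric] mult_ac)

text \<open>Forget that the path ends at n and sort by the number m <= n of gaps, all at most n. At
  this H the factor exp (H m) cancels the growth of \<open>words_partition\<close>, each m gives at
  most exp 1, and Z grows at most linearly.\<close>

lemma free_energy_nonpos:
  assumes "\<epsilon> > 0"
  shows "\<exists>b0>0. \<forall>b. 0 \<le> b \<longrightarrow> b \<le> b0 \<longrightarrow> free_energy (- b * (\<kappa> + \<epsilon>)) b \<le> 0"
proof -
  obtain b0 where "b0 > 0" and b0: "\<And>b R m. 0 \<le> b \<Longrightarrow> b \<le> b0 \<Longrightarrow>
      words_partition b R m \<le> exp 1 * exp (b * (\<kappa> + \<epsilon>)) ^ m"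
    using words_partition_le[OF assms] by blast
  moreover have "free_energy (- b * (\<kappa> + \<epsilon>)) b \<le> 0" if b: "0 \<le> b" "b \<le> b0" for b
  proof (rule LIMSEQ_le[OF free_energy_LIMSEQ[OF b(1)]])
    let ?H = "- b * (\<kappa> + \<epsilon>)"
    have Z: "Z ?H b n \<le> exp 1 * (real n + 1)" for n
    proof -
      let ?f = "\<lambda>ts. weight ts * exp (?H * length ts + b * energy \<rho> ts)"
      have "Z ?H b n \<le> (\<Sum>ts\<in>(\<Union>m\<in>{..n}. words n m). ?f ts)"
        unfolding Z_def using compositions_subset_words[of n] finite_words
        by (intro sum_mono2) (auto intro!: mult_nonneg_nonneg less_imp_le[OF weight_pos_words])
      also have "\<dots> = (\<Sum>m\<le>n. \<Sum>ts\<in>words n m. ?f ts)"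
        by (intro sum.UNION_disjoint) (auto simp: finite_words, auto simp: words_def)
      also have "\<dots> \<le> (\<Sum>m\<le>n. exp 1)"
        unfolding sum_words_eq_words_partition
      proof (rule sum_mono)
        fix m
        have "exp ?H ^ m * words_partition b n m \<le> exp ?H ^ m * (exp 1 * exp (b * (\<kappa> + \<epsilon>)) ^ m)"
          using b by (intro mult_left_mono b0) auto
        also have "\<dots> = exp 1" by (simp add: mult.left_commute power_mult_distrib[symmetric] exp_add[symmetric])
        finally show "exp ?H ^ m * words_partition b n m \<le> exp 1" .
      qed
      finally show ?thesis by (simp add: algebra_simps)
    qed
    show "(\<lambda>n. (1 + ln (real n + 1)) / real n) \<longlonglongrightarrow> 0" by real_asymp
    show "\<exists>N. \<forall>n\<ge>N. ln (Z ?H b n) / real n \<le> (1 + ln (real n + 1)) / real n"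
    proof (intro exI allI impI)
      fix n :: nat assume n: "n \<ge> 1"
      have "ln (Z ?H b n) \<le> ln (exp 1 * (real n + 1))"
        using Z[of n] Z_pos[OF n] by (intro ln_mono)
      also have "\<dots> = 1 + ln (real n + 1)" using ln_mult[of "exp 1" "real n + 1"] by simp
      finally show "ln (Z ?H b n) / real n \<le> (1 + ln (real n + 1)) / real n"
        by (intro divide_right_mono) auto
    qed
  qed
  ultimately show ?thesis by blast
qed

text \<open>Words of m gaps of size at most R end somewhere in 0..R m, so their total weight is at
  most a sum of R m + 1 partition functions. If the free energy were not positive, these would grow
  too slowly for the exponential lower bound in m.\<close>

lemma free_energy_pos:
  assumes \<epsilon>: "\<epsilon> > 0" and b: "b > 0"
  shows "free_energy (- b * (\<kappa> - \<epsilon>)) b > 0"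
proof (rule ccontr)
  let ?H = "- b * (\<kappa> - \<epsilon>)"
  assume "\<not> free_energy ?H b > 0"
  then have le: "free_energy ?H b \<le> 0" by simp
  obtain R C where C: "C > 0" and RC: "\<And>m. words_partition b R m \<ge> C * exp (b * (\<kappa> - \<epsilon> / 2)) ^ m"
    using words_partition_ge[of "\<epsilon> / 2" b] assms by auto
  \<comment> \<open>At this H the lower bound with \<epsilon> / 2 grows at rate b \<epsilon> / 2 = 2
    a per gap. The rate \<delta> per unit length spends at most a of it, since a gap has length at
    most R; adding 1 in the denominator of \<delta> covers R = 0.\<close>
  define a where "a = b * \<epsilon> / 4"
  have a: "a > 0" using assms by (simp add: a_def)
  define \<delta> where "\<delta> = a / (real R + 1)"
  have \<delta>: "\<delta> > 0" "\<delta> * real R \<le> a" using a by (auto simp: \<delta>_def field_simps)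
  have "\<forall>\<^sub>F n in sequentially. ln (Z ?H b n) / real n < \<delta>"
    using le \<delta> b by (intro order_tendstoD[OF free_energy_LIMSEQ]) auto
  then obtain n0 where n0: "\<And>n. n \<ge> n0 \<Longrightarrow> ln (Z ?H b n) / real n < \<delta>"
    by (auto simp: eventually_sequentially)
  \<comment> \<open>D absorbs the finitely many n for which the bound with rate \<delta> has not yet
    set in.\<close>
  define D where "D = 1 + (\<Sum>n\<le>n0. Z ?H b n)"
  have Z0: "Z ?H b n \<ge> 0" for n
    unfolding Z_def by (auto intro!: sum_nonneg mult_nonneg_nonneg less_imp_le[OF weight_pos_compositions])
  then have D: "D \<ge> 1" by (simp add: D_def sum_nonneg)
  have Z: "Z ?H b n \<le> D * exp (\<delta> * real n)" for n
  proof (cases "n \<le> n0")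
    case True
    then have "Z ?H b n \<le> D * 1" using member_le_sum[of n "{..n0}" "Z ?H b"] Z0 by (simp add: D_def)
    also have "\<dots> \<le> D * exp (\<delta> * real n)" using D \<delta> by (intro mult_left_mono) auto
    finally show ?thesis .
  next
    case False
    then have n: "n \<ge> 1" by simp
    have "ln (Z ?H b n) \<le> \<delta> * real n" using n0[of n] False n by (simp add: field_simps)
    then have "Z ?H b n \<le> 1 * exp (\<delta> * real n)" using Z_pos[OF n, of ?H b] exp_ln[OF Z_pos[OF n, of ?H b]]
      exp_le_cancel_iff[of "ln (Z ?H b n)" "\<delta> * real n"] by simp
    also have "\<dots> \<le> D * exp (\<delta> * real n)" using D by (intro mult_right_mono) auto
    finally show ?thesis .
  qed
  have growth: "C * exp (a * real m) \<le> (real R * real m + 1) * D" for m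
  proof -
    let ?f = "\<lambda>ts. weight ts * exp (?H * length ts + b * energy \<rho> ts)"
    have "C * exp (2 * a) ^ m = exp ?H ^ m * (C * exp (b * (\<kappa> - \<epsilon> / 2)) ^ m)"
      by (simp add: mult.left_commute power_mult_distrib[symmetric] exp_add[symmetric] a_def algebra_simps)
    also have "\<dots> \<le> exp ?H ^ m * words_partition b R m"
      by (intro mult_left_mono RC) auto
    also have "\<dots> = (\<Sum>ts\<in>words R m. ?f ts)" by (rule sum_words_eq_words_partition[symmetric])
    also have "\<dots> \<le> (\<Sum>ts\<in>(\<Union>n\<in>{..R * m}. compositions n). ?f ts)"
      using words_subset_compositions[of R m] finite_compositions
      by (intro sum_mono2) (auto intro!: mult_nonneg_nonneg less_imp_le[OF weight_pos_compositions])
    also have "\<dots> = (\<Sum>n\<le>R * m. Z ?H b n)"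
      unfolding Z_def by (intro sum.UNION_disjoint) (auto simp: finite_compositions, auto simp: compositions_def)
    also have "\<dots> \<le> (\<Sum>n\<le>R * m. D * exp (a * real m))"
    proof (intro sum_mono order_trans[OF Z] mult_left_mono)
      fix n assume "n \<in> {..R * m}"
      then have "real n \<le> real R * real m" by (metis atMost_iff of_nat_le_iff of_nat_mult)
      then have "\<delta> * real n \<le> \<delta> * (real R * real m)" using \<delta> by (intro mult_left_mono) auto
      also have "\<dots> \<le> a * real m" using \<delta> mult_right_mono[of "\<delta> * real R" a "real m"] by (simp add: mult.assoc)
      finally show "exp (\<delta> * real n) \<le> exp (a * real m)" by simp
    qed (use D in auto)
    also have "\<dots> = (real R * real m + 1) * D * exp (a * real m)" by (simp add: algebra_simps)
    finally have "C * exp (2 * a) ^ m * exp (- a * real m) \<le>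
        (real R * real m + 1) * D * exp (a * real m) * exp (- a * real m)"
      by (intro mult_right_mono) auto
    then show ?thesis by (simp add: mult.assoc exp_of_nat_mult[symmetric] exp_add[symmetric] algebra_simps)
  qed
  have "(\<lambda>m. (real R * real m + 1) * D * exp (- a * real m)) \<longlonglongrightarrow> 0"
    using a by real_asymp
  moreover have "C \<le> (real R * real m + 1) * D * exp (- a * real m)" for m
    using mult_right_mono[OF growth[of m], of "exp (- a * real m)"]
    by (simp add: mult.assoc exp_add[symmetric])
  ultimately have "C \<le> 0" by (intro LIMSEQ_le_const) auto
  with C show False by simp
qed

text \<open>A single jump already gives Z >= K(n) exp H. The limit is known to exist, so it can be
  read off along powers of 2, the scale on which slow variation controls K by iterated
  doubling.\<close>

lemma free_energy_nonneg:
  assumes "b \<ge> 0" and "(\<lambda>k. ln (K (2 ^ k)) / 2 ^ k) \<longlonglongrightarrow> 0"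
  shows "free_energy H b \<ge> 0"
proof -
  have sm: "strict_mono (\<lambda>k. 2 ^ k :: nat)" by (auto simp: strict_mono_def)
  have "(\<lambda>k. ln (Z H b (2 ^ k)) / real (2 ^ k)) \<longlonglongrightarrow> free_energy H b"
    using LIMSEQ_subseq_LIMSEQ[OF free_energy_LIMSEQ[OF assms(1), of H] sm] by (simp add: o_def)
  moreover have "(\<lambda>k. ln (K (2 ^ k)) / 2 ^ k + H / 2 ^ k) \<longlonglongrightarrow> 0 + 0"
    by (intro tendsto_add assms) real_asymp
  moreover have "ln (K (2 ^ k)) / 2 ^ k + H / 2 ^ k \<le> ln (Z H b (2 ^ k)) / real (2 ^ k)" for k
  proof -
    have K: "K (2 ^ k) > 0" by (intro K_pos) simp
    have "ln (K (2 ^ k)) + H = ln (K (2 ^ k) * exp H)" using K by (simp add: ln_mult)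
    also have "\<dots> \<le> ln (Z H b (2 ^ k))" using K by (intro ln_mono Z_ge_single) auto
    finally show ?thesis by (simp add: add_divide_distrib[symmetric] divide_right_mono)
  qed
  ultimately show ?thesis by (intro LIMSEQ_le[where X = "\<lambda>k. ln (K (2 ^ k)) / 2 ^ k + H / 2 ^ k"]) auto
qed

subsection \<open>Positivity of the limit constant\<close>

text \<open>The covariance matrix of the disorder, see \<open>expectation_\<omega>_mult\<close>;
  maximum minus minimum is the distance in natural numbers.\<close>

definition corr :: "nat \<Rightarrow> nat \<Rightarrow> real" where
  "corr i j = (if i = j then 1 else \<rho> (max i j - min i j))"

text \<open>On the diagonal this is the variance of the linear combination of \<omega> with
  coefficients c. Its nonnegativity is what the disorder contributes to the positivity of 1 + 2
  \<kappa>.\<close>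

definition bilinear_form :: "nat \<Rightarrow> (nat \<Rightarrow> real) \<Rightarrow> (nat \<Rightarrow> real) \<Rightarrow> real" where
  "bilinear_form P c d = (\<Sum>i\<le>P. \<Sum>j\<le>P. c i * d j * corr i j)"

definition unit_seq :: "nat \<Rightarrow> nat \<Rightarrow> real" where
  "unit_seq k i = of_bool (i = k)"

text \<open>The contacts as a coefficient vector; its variance is the number of contacts plus twice
  the energy.\<close>

definition visits :: "nat \<Rightarrow> nat list \<Rightarrow> nat \<Rightarrow> real" where
  "visits e ts i = psum (\<lambda>k. unit_seq k i) e ts"

lemma corr_commute: "corr i j = corr j i"
  by (simp add: corr_def max.commute min.commute)

lemma bilinear_form_commute: "bilinear_form P c d = bilinear_form P d c"
  unfolding bilinear_form_def by (subst sum.swap) (simp add: mult_ac corr_commute)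

lemma bilinear_form_add_left:
  "bilinear_form P (\<lambda>i. c i + c' i) d = bilinear_form P c d + bilinear_form P c' d"
  by (simp add: bilinear_form_def algebra_simps sum.distrib)

lemma bilinear_form_scale_left: "bilinear_form P (\<lambda>i. a * c i) d = a * bilinear_form P c d"
  by (simp add: bilinear_form_def sum_distrib_left mult_ac)

lemma bilinear_form_add_right:
  "bilinear_form P d (\<lambda>i. c i + c' i) = bilinear_form P d c + bilinear_form P d c'"
  by (simp add: bilinear_form_def algebra_simps sum.distrib)

lemma bilinear_form_scale_right: "bilinear_form P d (\<lambda>i. a * c i) = a * bilinear_form P d c"
  by (simp add: bilinear_form_def sum_distrib_left mult_ac)

lemma bilinear_form_unit_left:
  assumes "k \<le> P"
  shows "bilinear_form P (unit_seq k) d = (\<Sum>j\<le>P. d j * corr k j)"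
proof -
  have "bilinear_form P (unit_seq k) d = (\<Sum>i\<le>P. if i = k then \<Sum>j\<le>P. d j * corr k j else 0)"
    unfolding bilinear_form_def by (intro sum.cong refl) (auto simp: unit_seq_def)
  then show ?thesis using assms by simp
qed

lemma bilinear_form_unit_unit:
  assumes "k \<le> P" "l \<le> P"
  shows "bilinear_form P (unit_seq k) (unit_seq l) = corr k l"
proof -
  have "(\<Sum>j\<le>P. unit_seq l j * corr k j) = (\<Sum>j\<le>P. if j = l then corr k l else 0)"
    by (intro sum.cong refl) (auto simp: unit_seq_def)
  then show ?thesis using assms by (simp add: bilinear_form_unit_left)
qed

lemma visits_simps [simp]:
  "visits e [] = (\<lambda>_. 0)"
  "visits e (t # ts) = (\<lambda>i. unit_seq (e + t) i + visits (e + t) ts i)"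
  by (auto simp: visits_def)

lemma sum_visits:
  assumes "s + sum_list ts \<le> P"
  shows "(\<Sum>j\<le>P. visits s ts j * f j) = psum f s ts"
  using assms
proof (induction ts arbitrary: s)
  case (Cons t ts)
  have "(\<Sum>j\<le>P. unit_seq (s + t) j * f j) = (\<Sum>j\<le>P. if j = s + t then f (s + t) else 0)"
    by (intro sum.cong refl) (auto simp: unit_seq_def)
  with Cons show ?case by (simp add: distrib_right sum.distrib)
qed simp

lemma psum_corr:
  assumes "0 \<notin> set ts"
  shows "psum (corr k) (k + s) ts = psum \<rho> s ts"
  using assms
proof (induction ts arbitrary: s)
  case (Cons t ts)
  have "corr k (k + (s + t)) = \<rho> (s + t)" using Cons.prems by (simp add: corr_def)
  with Cons show ?case by (simp add: add.assoc)
qed simp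

lemma bilinear_form_visits:
  assumes "e + sum_list ts \<le> P" "0 \<notin> set ts"
  shows "bilinear_form P (visits e ts) (visits e ts) = length ts + 2 * energy \<rho> ts"
  using assms
proof (induction ts arbitrary: e)
  case Nil
  then show ?case by (simp add: bilinear_form_def)
next
  case (Cons t ts)
  have "bilinear_form P (unit_seq (e + t)) (visits (e + t) ts) = psum \<rho> 0 ts"
    using Cons.prems psum_corr[of ts "e + t" 0] by (simp add: bilinear_form_unit_left sum_visits)
  moreover have "bilinear_form P (unit_seq (e + t)) (unit_seq (e + t)) = 1"
    using Cons.prems by (simp add: bilinear_form_unit_unit corr_def)
  ultimately show ?case
    using Cons
    by (simp add: bilinear_form_add_left bilinear_form_add_right add.assoc
        bilinear_form_commute[of P "visits (e + t) ts" "unit_seq (e + t)"])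
qed

text \<open>The mean of two squared norms exceeds the squared norm of the midpoint by a quarter of
  the squared norm of the difference. For unit vectors k and l that difference has squared norm 2 -
  2 \<open>corr k l\<close>.\<close>

lemma parallelogram:
  fixes c :: "nat \<Rightarrow> real"
  assumes "k \<le> P" "l \<le> P"
  shows "(bilinear_form P (\<lambda>i. c i + unit_seq k i) (\<lambda>i. c i + unit_seq k i) +
      bilinear_form P (\<lambda>i. c i + unit_seq l i) (\<lambda>i. c i + unit_seq l i)) / 2 =
    bilinear_form P (\<lambda>i. c i + (1 / 2 * unit_seq k i + 1 / 2 * unit_seq l i))
      (\<lambda>i. c i + (1 / 2 * unit_seq k i + 1 / 2 * unit_seq l i)) + (1 - corr k l) / 2"
  using assms
  by (simp only: bilinear_form_add_left bilinear_form_add_right bilinear_form_scale_left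
      bilinear_form_scale_right bilinear_form_unit_unit bilinear_form_commute[of P "unit_seq _" c]
      corr_commute[of l k])
     (simp add: corr_def field_simps)

lemma sum_symmetrize:
  "(\<Sum>t\<in>A. \<Sum>u\<in>A. K t * K u * S t u) = (\<Sum>t\<in>A. \<Sum>u\<in>A. K t * K u * ((S t u + S u t) / 2))"
proof -
  have "(\<Sum>t\<in>A. \<Sum>u\<in>A. K t * K u * S u t) = (\<Sum>t\<in>A. \<Sum>u\<in>A. K t * K u * S t u)"
    by (subst sum.swap) (simp only: mult.commute)
  then show ?thesis
    by (simp add: distrib_left add_divide_distrib sum.distrib sum_divide_distrib[symmetric])
qed

definition swap_gain :: "real \<Rightarrow> nat \<Rightarrow> real" where
  "swap_gain b R = (\<Sum>t=1..R. \<Sum>u=1..R. K t * K u * exp (b / 2 * ((1 - corr t u) / 2)))"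

(* Exchanging two consecutive gaps t and u moves a single renewal point, and averaging over the
   exchange gains the factor exp (b / 2 * ((1 - corr t u) / 2)) by convexity of exp. *)
lemma swap_gain_power_le:
  assumes pd: "\<And>c. bilinear_form P c c \<ge> 0" and b: "b \<ge> 0" and "e + 2 * m * R \<le> P"
  shows "(\<Sum>ts\<in>words R (2 * m). weight ts * exp (b / 2 *
      bilinear_form P (\<lambda>i. c i + visits e ts i) (\<lambda>i. c i + visits e ts i))) \<ge> swap_gain b R ^ m"
  using assms(3)
\<comment> \<open>The offset c must range over all real vectors: averaging over an exchange puts
  coefficient 1/2 on both candidate middle contacts, and the induction hypothesis is applied to that
  midpoint.\<close>
proof (induction m arbitrary: c e)
  case 0
  show ?case using pd[of c] b by (simp add: words_0)
next
  case (Suc m)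
  let ?Q = "\<lambda>c. exp (b / 2 * bilinear_form P c c)"
  let ?x = "\<lambda>t u ts i. c i + unit_seq (e + t + u) i + visits (e + t + u) ts i"
  \<comment> \<open>S t u collects the paths with first gaps t, u. Both orders share the contact e +
    t + u and all later ones; S t u has the middle contact e + t, S u t has e + u.\<close>
  define S where "S t u = (\<Sum>ts\<in>words R (2 * m). weight ts * ?Q (\<lambda>i. ?x t u ts i + unit_seq (e + t) i))" for t u
  have gain: "2 * (exp (b / 2 * ((1 - corr t u) / 2)) * swap_gain b R ^ m) \<le> S t u + S u t"
    if tu: "t \<in> {1..R}" "u \<in> {1..R}" for t u
  proof -
    have P: "e + t \<le> P" "e + u \<le> P" "e + t + u + 2 * m * R \<le> P"
      using tu Suc.prems by auto
    have corr: "corr (e + t) (e + u) = corr t u" by (cases t u rule: linorder_cases) (simp_all add: corr_def max_def min_def)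
    let ?d = "\<lambda>i. c i + unit_seq (e + t + u) i + (1 / 2 * unit_seq (e + t) i + 1 / 2 * unit_seq (e + u) i)"
    have "2 * (exp (b / 2 * ((1 - corr t u) / 2)) * swap_gain b R ^ m) \<le>
        2 * (exp (b / 2 * ((1 - corr t u) / 2)) *
          (\<Sum>ts\<in>words R (2 * m). weight ts * ?Q (\<lambda>i. ?d i + visits (e + t + u) ts i)))"
      by (intro mult_left_mono Suc.IH P) auto
    also have "\<dots> = (\<Sum>ts\<in>words R (2 * m). weight ts * (2 * exp (b / 2 * ((1 - corr t u) / 2) +
          b / 2 * bilinear_form P (\<lambda>i. ?d i + visits (e + t + u) ts i) (\<lambda>i. ?d i + visits (e + t + u) ts i))))"
      by (simp only: sum_distrib_left exp_add mult_ac)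
    also have "\<dots> \<le> (\<Sum>ts\<in>words R (2 * m). weight ts *
        (?Q (\<lambda>i. ?x t u ts i + unit_seq (e + t) i) + ?Q (\<lambda>i. ?x t u ts i + unit_seq (e + u) i)))"
    proof (intro sum_mono mult_left_mono less_imp_le[OF weight_pos_words])
      fix ts
      have d: "(\<lambda>i. ?d i + visits (e + t + u) ts i) =
          (\<lambda>i. ?x t u ts i + (1 / 2 * unit_seq (e + t) i + 1 / 2 * unit_seq (e + u) i))"
        by (simp add: add_ac)
      show "2 * exp (b / 2 * ((1 - corr t u) / 2) +
          b / 2 * bilinear_form P (\<lambda>i. ?d i + visits (e + t + u) ts i) (\<lambda>i. ?d i + visits (e + t + u) ts i))
        \<le> ?Q (\<lambda>i. ?x t u ts i + unit_seq (e + t) i) + ?Q (\<lambda>i. ?x t u ts i + unit_seq (e + u) i)"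
        using exp_convex_mid[of "b / 2 * bilinear_form P (\<lambda>i. ?x t u ts i + unit_seq (e + t) i) (\<lambda>i. ?x t u ts i + unit_seq (e + t) i)"
            "b / 2 * bilinear_form P (\<lambda>i. ?x t u ts i + unit_seq (e + u) i) (\<lambda>i. ?x t u ts i + unit_seq (e + u) i)"]
          parallelogram[OF P(1,2), of "?x t u ts"]
        unfolding d corr by (simp only: distrib_left[symmetric] times_divide_eq_right[symmetric] add.commute)
    qed
    also have "\<dots> = S t u + S u t"
      unfolding S_def by (simp only: distrib_left sum.distrib add.commute[of u] add.assoc[of _ u] add.assoc[of _ t] add.assoc[of _ u t])
    finally show ?thesis .
  qed
  have half: "2 * x \<le> y \<Longrightarrow> x \<le> y / 2" for x y :: real by simp
  let ?KK = "\<lambda>f. \<Sum>t=1..R. \<Sum>u=1..R. K t * K u * f t u"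
  have "(\<Sum>ts\<in>words R (2 * Suc m). weight ts * ?Q (\<lambda>i. c i + visits e ts i)) =
      (\<Sum>ts\<in>words R (2 * m). \<Sum>u=1..R. \<Sum>t=1..R. K t * K u *
        (weight ts * ?Q (\<lambda>i. ?x t u ts i + unit_seq (e + t) i)))"
    by (simp add: sum_words_Suc mult_ac add_ac)
  also have "\<dots> = ?KK S"
    unfolding S_def sum_distrib_left
    by (subst sum.swap, subst (2) sum.swap, subst sum.swap) (rule refl)
  also have "\<dots> = ?KK (\<lambda>t u. (S t u + S u t) / 2)" by (rule sum_symmetrize)
  also have "\<dots> \<ge> ?KK (\<lambda>t u. exp (b / 2 * ((1 - corr t u) / 2)) * swap_gain b R ^ m)"
  proof (intro sum_mono mult_left_mono)
    fix t u assume tu: "t \<in> {1..R}" "u \<in> {1..R}"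
    show "exp (b / 2 * ((1 - corr t u) / 2)) * swap_gain b R ^ m \<le> (S t u + S u t) / 2"
      by (rule half[OF gain[OF tu]])
    show "0 \<le> K t * K u" using tu by (intro mult_nonneg_nonneg less_imp_le[OF K_pos]) auto
  qed
  finally show ?case
    by (simp add: swap_gain_def sum_distrib_right mult_ac)
qed

text \<open>If 1 + 2 \<kappa> <= 0, then \<open>words_partition_le\<close> bounds the average of exp
  (b/2 times the variance) over 2 m gaps by exp 1 times exp (2 b \<epsilon> m). The exchange
  argument bounds it below by \<open>swap_gain b R ^ m\<close>. Letting m grow compares the bases, R
  to infinity restores the full kernel mass, and the first order terms in b then contradict each
  other.\<close>

lemma one_plus_two_\<kappa>_pos:
  assumes pd: "\<And>P c. bilinear_form P c c \<ge> 0"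
  shows "1 + 2 * \<kappa> > 0"
proof (rule ccontr)
  assume "\<not> 1 + 2 * \<kappa> > 0"
  then have \<kappa>: "1 + 2 * \<kappa> \<le> 0" by simp
  \<comment> \<open>The variance of the difference of two disorder variables is 2 - 2
    \<open>corr t u\<close>. The bound makes every exponent in \<open>swap_gain\<close> nonnegative,
    so a single pair of gaps can be singled out below.\<close>
  have corr_le: "corr t u \<le> 1" for t u
  proof -
    let ?c = "\<lambda>i. unit_seq t i + (- 1) * unit_seq u i"
    have "bilinear_form (max t u) ?c ?c = 2 - 2 * corr t u"
      by (simp only: bilinear_form_add_left bilinear_form_add_right bilinear_form_scale_left
        bilinear_form_scale_right bilinear_form_unit_unit max.cobounded1 max.cobounded2 corr_commute[of u t])
       (simp add: corr_def)
    then show ?thesis using pd[of "max t u" ?c] by simp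
  qed
  have "(\<lambda>n. \<bar>\<rho> (Suc n)\<bar>) \<longlonglongrightarrow> 0" using \<rho>_summable by (rule summable_LIMSEQ_zero)
  then have "\<forall>\<^sub>F n in sequentially. \<bar>\<rho> (Suc n)\<bar> < 1" by (intro order_tendstoD) auto
  then obtain d where d: "d \<ge> 1" "\<rho> d < 1" by (auto simp: eventually_sequentially abs_less_iff) 
  \<comment> \<open>Exchanging the gaps 1 and 1 + d moves the middle contact by d. q is the weight
    of this pair times its gain, positive because \<rho> d < 1.\<close>
  define q where "q = K 1 * K (1 + d) * ((1 - \<rho> d) / 2)"
  have q: "q > 0" using d by (auto simp: q_def intro!: mult_pos_pos K_pos)
  \<comment> \<open>With 2 b \<epsilon> <= 1, exp (2 b \<epsilon>) is at most 1 + 4 b \<epsilon> = 1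
    + b q / 4, strictly below the 1 + b q / 2 obtained from the exchange.\<close>
  define \<epsilon> where "\<epsilon> = q / 16"
  have \<epsilon>: "\<epsilon> > 0" using q by (simp add: \<epsilon>_def)
  obtain b0 where "b0 > 0" and b0: "\<And>b R m. 0 \<le> b \<Longrightarrow> b \<le> b0 \<Longrightarrow>
      words_partition b R m \<le> exp 1 * exp (b * (\<kappa> + \<epsilon>)) ^ m"
    using words_partition_le[OF \<epsilon>] by blast
  define b where "b = min b0 (1 / (2 * \<epsilon>))"
  have b: "b > 0" "b \<le> b0" "2 * b * \<epsilon> \<le> 1"
    using \<open>b0 > 0\<close> \<epsilon> by (auto simp: b_def min_def field_simps)
  have gain_le: "swap_gain b R \<le> exp (2 * b * \<epsilon>)" for R
  proof (rule ccontr)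
    assume "\<not> swap_gain b R \<le> exp (2 * b * \<epsilon>)"
    then have gt: "swap_gain b R / exp (2 * b * \<epsilon>) > 1" by (simp add: field_simps)
    have "(swap_gain b R / exp (2 * b * \<epsilon>)) ^ m \<le> exp 1" for m
    proof -
      have "swap_gain b R ^ m \<le> (\<Sum>ts\<in>words R (2 * m). weight ts * exp (b / 2 *
          bilinear_form (2 * m * R) (\<lambda>i. 0 + visits 0 ts i) (\<lambda>i. 0 + visits 0 ts i)))"
        using b pd by (intro swap_gain_power_le) auto
      also have "\<dots> = (\<Sum>ts\<in>words R (2 * m). weight ts * exp (b / 2 * length ts + b * energy \<rho> ts))"
      proof (intro sum.cong refl)
        fix ts assume ts: "ts \<in> words R (2 * m)"
        then have "sum_list ts \<le> R * (2 * m)" using words_subset_compositions[of R "2 * m"]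
          by (auto simp: compositions_def)
        then show "weight ts * exp (b / 2 * bilinear_form (2 * m * R) (\<lambda>i. 0 + visits 0 ts i) (\<lambda>i. 0 + visits 0 ts i)) =
            weight ts * exp (b / 2 * length ts + b * energy \<rho> ts)"
          using bilinear_form_visits[of 0 ts "2 * m * R"] words_positive[OF ts] by (simp add: mult_ac algebra_simps)
      qed
      also have "\<dots> = exp (b / 2) ^ (2 * m) * words_partition b R (2 * m)"
        by (rule sum_words_eq_words_partition)
      also have "\<dots> \<le> exp (b / 2) ^ (2 * m) * (exp 1 * exp (b * (\<kappa> + \<epsilon>)) ^ (2 * m))"
        using b by (intro mult_left_mono b0) auto
      also have "\<dots> = exp 1 * exp (b * (1 + 2 * \<kappa>) + 2 * b * \<epsilon>) ^ m"
        by (simp add: power_mult power_mult_distrib[symmetric] exp_double[symmetric] exp_add[symmetric]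
            mult.left_commute[of _ "exp 1"] power2_eq_square algebra_simps)
      also have "\<dots> \<le> exp 1 * exp (2 * b * \<epsilon>) ^ m"
        using \<kappa> b by (intro mult_left_mono power_mono) (auto simp: mult_le_0_iff)
      finally have *: "swap_gain b R ^ m \<le> exp 1 * exp (2 * b * \<epsilon>) ^ m" .
      then show ?thesis by (simp add: power_divide divide_le_eq)
    qed
    moreover obtain m where "exp 1 < (swap_gain b R / exp (2 * b * \<epsilon>)) ^ m"
      using real_arch_pow[OF gt] by blast
    ultimately show False by (meson not_le)
  qed
  have "(\<Sum>t=1..R. K t)\<^sup>2 + b / 2 * q \<le> exp (2 * b * \<epsilon>)" if R: "R \<ge> 1 + d" for R
  proof -
    let ?g = "\<lambda>t u. K t * K u * (b / 2 * ((1 - corr t u) / 2))"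
    have g0: "0 \<le> ?g t u" if "t \<ge> 1" "u \<ge> 1" for t u
      using that b corr_le[of t u] by (intro mult_nonneg_nonneg less_imp_le[OF K_pos]) auto
    have "b / 2 * q = ?g 1 (1 + d)" using d by (simp add: q_def corr_def)
    also have "\<dots> \<le> (\<Sum>u=1..R. ?g 1 u)"
      using R g0 by (intro member_le_sum) auto
    also have "\<dots> \<le> (\<Sum>t=1..R. \<Sum>u=1..R. ?g t u)"
      using R g0 by (intro member_le_sum[of 1 _ "\<lambda>t. \<Sum>u=1..R. ?g t u"] sum_nonneg) auto
    finally have "(\<Sum>t=1..R. K t)\<^sup>2 + b / 2 * q \<le>
        (\<Sum>t=1..R. \<Sum>u=1..R. K t * K u * (1 + b / 2 * ((1 - corr t u) / 2)))"
      by (simp add: power2_eq_square sum_product distrib_left sum.distrib)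
    also have "\<dots> \<le> swap_gain b R"
      unfolding swap_gain_def
      by (intro sum_mono mult_left_mono exp_ge_add_one_self mult_nonneg_nonneg less_imp_le[OF K_pos]) auto
    also note gain_le
    finally show ?thesis .
  qed
  moreover have "(\<lambda>R. (\<Sum>t=1..R. K t)\<^sup>2 + b / 2 * q) \<longlonglongrightarrow> 1\<^sup>2 + b / 2 * q"
    by (intro tendsto_intros sum_K_tendsto_1)
  ultimately have "1\<^sup>2 + b / 2 * q \<le> exp (2 * b * \<epsilon>)"
    by (intro LIMSEQ_le_const2) blast+
  also have "\<dots> \<le> 1 + 2 * b * \<epsilon> + (2 * b * \<epsilon>)\<^sup>2"
    using b \<epsilon> by (intro exp_le_quadratic) auto
  also have "(2 * b * \<epsilon>)\<^sup>2 \<le> 2 * b * \<epsilon> * 1"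
    unfolding power2_eq_square using b \<epsilon> by (intro mult_left_mono) auto
  finally have "b * q / 2 \<le> b * q / 4" by (simp add: \<epsilon>_def)
  then show False using b q mult_pos_pos[of b q] by simp
qed

end

section \<open>Reduction to gap lists\<close>

definition gaps :: "(nat \<Rightarrow> 'a \<Rightarrow> nat) \<Rightarrow> nat \<Rightarrow> 'a \<Rightarrow> nat list" where
  "gaps T m x = map (\<lambda>i. T (Suc i) x) [0..<m]"

lemma length_gaps [simp]: "length (gaps T m x) = m"
  by (simp add: gaps_def)

lemma gaps_Suc: "gaps T (Suc m) x = gaps T m x @ [T (Suc m) x]"
  by (simp add: gaps_def)

lemma renewal_time_Suc: "renewal_time T (Suc m) x = renewal_time T m x + T (Suc m) x"
  by (simp add: renewal_time_def)

lemma sum_list_gaps: "sum_list (gaps T m x) = renewal_time T m x"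
  by (induction m) (auto simp: gaps_Suc renewal_time_Suc renewal_time_def gaps_def)

lemma psum_gaps: "psum f 0 (gaps T m x) = (\<Sum>j=1..m. f (renewal_time T j x))"
proof (induction m)
  case 0
  then show ?case by (simp add: gaps_def)
next
  case (Suc m)
  then show ?case
    by (simp add: gaps_Suc psum_append sum_list_gaps renewal_time_Suc)
qed

context
  fixes T :: "nat \<Rightarrow> 'a \<Rightarrow> nat" and x :: 'a
  assumes T_pos: "\<And>i. i \<ge> 1 \<Longrightarrow> T i x \<ge> 1"
begin

lemma strict_mono_renewal_time: "strict_mono (\<lambda>k. renewal_time T k x)"
  unfolding strict_mono_Suc_iff renewal_time_Suc using T_pos by (simp add: Suc_le_eq)

text \<open>Renewal times increase strictly, so n is reached at one index only; this makes the later
  sums over compositions disjoint.\<close>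

lemma renewal_set_gaps:
  assumes "n \<in> renewal_set T x"
  shows "\<exists>!m. gaps T m x \<in> compositions n"
proof -
  have *: "gaps T m x \<in> compositions n \<longleftrightarrow> renewal_time T m x = n" for m
  proof -
    have "0 \<notin> set (gaps T m x)" by (auto simp: gaps_def) (metis T_pos One_nat_def Suc_le_mono le_zero_eq not_less_eq_eq zero_le)
    then show ?thesis by (simp add: compositions_def sum_list_gaps)
  qed
  show ?thesis
    using assms strict_mono_eq[OF strict_mono_renewal_time]
    unfolding * by (auto simp: renewal_set_def)
qed

text \<open>The renewal points in {1..n} are those with indices 1 to m: index 0 is the origin, which
  the sum leaves out, and later indices exceed n.\<close>

lemma sum_contact:
  assumes "gaps T m x \<in> compositions n"
  shows "(\<Sum>k=1..n. f k * contact T k x) = psum f 0 (gaps T m x)"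
proof -
  have n: "renewal_time T m x = n" using assms by (simp add: compositions_def sum_list_gaps)
  have less_iff: "renewal_time T j x < renewal_time T k x \<longleftrightarrow> j < k" for j k
    by (rule strict_mono_less[OF strict_mono_renewal_time])
  have eq_iff: "renewal_time T j x = renewal_time T k x \<longleftrightarrow> j = k" for j k
    by (rule strict_mono_eq[OF strict_mono_renewal_time])
  have 0: "renewal_time T 0 x = 0" by (simp add: renewal_time_def)
  have "{1..n} \<inter> renewal_set T x = (\<lambda>j. renewal_time T j x) ` {1..m}"
  proof (intro equalityI subsetI)
    fix k assume "k \<in> {1..n} \<inter> renewal_set T x"
    then obtain j where "k = renewal_time T j x" "renewal_time T 0 x < k" "\<not> renewal_time T m x < k"
      by (auto simp: renewal_set_def n 0)
    then show "k \<in> (\<lambda>j. renewal_time T j x) ` {1..m}" by (auto simp: less_iff)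
  next
    fix k assume "k \<in> (\<lambda>j. renewal_time T j x) ` {1..m}"
    then obtain j where j: "k = renewal_time T j x" "0 < j" "\<not> m < j" by auto
    then have "renewal_time T 0 x < k" "\<not> renewal_time T m x < k" by (simp_all add: less_iff)
    then show "k \<in> {1..n} \<inter> renewal_set T x" using j(1) by (auto simp: renewal_set_def n 0)
  qed
  then have "(\<Sum>k\<in>{1..n} \<inter> renewal_set T x. f k) = (\<Sum>j=1..m. f (renewal_time T j x))"
    by (simp add: sum.reindex inj_on_def eq_iff)
  moreover have "(\<Sum>k=1..n. f k * contact T k x) = (\<Sum>k\<in>{1..n} \<inter> renewal_set T x. f k)"
    by (simp add: contact_def sum.inter_restrict indicator_def if_distrib cong: if_cong)
  ultimately show ?thesis by (simp add: psum_gaps)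
qed

end

section \<open>Exponential moments of Gaussian variables\<close>

lemma exp_normal_density:
  assumes "\<sigma> > 0"
  shows "normal_density 0 \<sigma> x * exp x = exp (\<sigma>\<^sup>2 / 2) * normal_density (\<sigma>\<^sup>2) \<sigma> x"
proof -
  \<comment> \<open>Completing the square: the exponential tilt moves the mean from 0 to the
    variance.\<close>
  have "- x\<^sup>2 / (2 * \<sigma>\<^sup>2) + x = \<sigma>\<^sup>2 / 2 + - (x - \<sigma>\<^sup>2)\<^sup>2 / (2 * \<sigma>\<^sup>2)"
    using assms by (simp add: field_simps power2_eq_square)
  then show ?thesis
    by (simp add: normal_density_def exp_add[symmetric] mult_ac)
qed

context prob_space
begin

lemma gaussian_square_integrable:
  assumes "gaussian_rv M X"
  shows "integrable M (\<lambda>x. (X x)\<^sup>2)"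
  using assms unfolding gaussian_rv_def
proof (elim conjE disjE exE)
  fix \<mu> \<sigma> assume X: "X \<in> borel_measurable M" and \<sigma>: "0 < \<sigma>"
    and D: "distributed M lborel X (normal_density \<mu> \<sigma>)"
  have int: "integrable lborel (\<lambda>x. normal_density \<mu> \<sigma> x * (x - \<mu>) ^ k)" for k
    using \<sigma> by (rule integrable_normal_moment)
  have "integrable lborel (\<lambda>x. normal_density \<mu> \<sigma> x * (x - \<mu>) ^ 2 +
      2 * \<mu> * (normal_density \<mu> \<sigma> x * (x - \<mu>) ^ 1) + \<mu>\<^sup>2 * (normal_density \<mu> \<sigma> x * (x - \<mu>) ^ 0))"
    by (intro Bochner_Integration.integrable_add integrable_mult_right int)
  then have "integrable lborel (\<lambda>x. normal_density \<mu> \<sigma> x * x\<^sup>2)"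
    by (rule Bochner_Integration.integrable_cong[THEN iffD1, rotated 2])
       (auto simp: power2_eq_square algebra_simps)
  then show ?thesis
    by (subst distributed_integrable[OF D, symmetric]) auto
next
  fix \<mu> assume "X \<in> borel_measurable M" "AE x in M. X x = \<mu>"
  moreover have "integrable M (\<lambda>_. \<mu>\<^sup>2)" by simp
  ultimately show ?thesis
    by (subst integrable_cong_AE[where g = "\<lambda>_. \<mu>\<^sup>2"]) auto
qed

text \<open>In the nondegenerate case the tilted density is again normal. A degenerate variable of
  mean 0 is almost surely 0 and both sides are 1; this case can occur for linear combinations of
  \<omega>.\<close>

lemma gaussian_expectation_exp:
  assumes "gaussian_rv M X" "expectation X = 0"
  shows "integrable M (\<lambda>x. exp (X x))"
    and "expectation (\<lambda>x. exp (X x)) = exp (expectation (\<lambda>x. (X x)\<^sup>2) / 2)"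
proof -
  have "integrable M (\<lambda>x. exp (X x)) \<and> expectation (\<lambda>x. exp (X x)) = exp (expectation (\<lambda>x. (X x)\<^sup>2) / 2)"
    using assms(1) unfolding gaussian_rv_def
  proof (elim conjE disjE exE)
    fix \<mu> \<sigma> assume X: "X \<in> borel_measurable M" and \<sigma>: "0 < \<sigma>"
      and D: "distributed M lborel X (normal_density \<mu> \<sigma>)"
    have "\<mu> = 0" using normal_distributed_expectation[OF \<sigma> D] assms(2) \<sigma> by simp
    with D have D: "distributed M lborel X (normal_density 0 \<sigma>)" by simp
    have "expectation (\<lambda>x. (X x)\<^sup>2) = \<sigma>\<^sup>2"
      using normal_distributed_variance[OF \<sigma> D] assms(2) by simp
    moreover have "integrable M (\<lambda>x. exp (X x))"
      by (subst distributed_integrable[OF D, symmetric]) (auto simp: exp_normal_density[OF \<sigma>] \<sigma>)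
    moreover have "expectation (\<lambda>x. exp (X x)) = (\<integral>x. exp (\<sigma>\<^sup>2 / 2) * normal_density (\<sigma>\<^sup>2) \<sigma> x \<partial>lborel)"
      by (subst distributed_integral[OF D, symmetric]) (auto simp: exp_normal_density[OF \<sigma>])
    ultimately show ?thesis using \<sigma> by simp
  next
    fix \<mu> assume X: "X \<in> borel_measurable M" and AE: "AE x in M. X x = \<mu>"
    have E: "expectation (\<lambda>x. g (X x)) = g \<mu>" if [measurable]: "g \<in> borel_measurable borel"
      for g :: "real \<Rightarrow> real"
    proof -
      have "expectation (\<lambda>x. g (X x)) = expectation (\<lambda>_. g \<mu>)"
        using X AE by (intro integral_cong_AE) auto
      then show ?thesis by (simp add: prob_space)
    qed
    have "\<mu> = 0" using E[of "\<lambda>x. x"] assms(2) by simp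
    moreover have "integrable M (\<lambda>x. exp (X x))"
      using X AE by (subst integrable_cong_AE[where g = "\<lambda>_. exp \<mu>"]) auto
    ultimately show ?thesis using E[of exp] E[of "\<lambda>x. x\<^sup>2"] by simp
  qed
  then show "integrable M (\<lambda>x. exp (X x))"
    "expectation (\<lambda>x. exp (X x)) = exp (expectation (\<lambda>x. (X x)\<^sup>2) / 2)" by auto
qed

lemma integrable_mult_of_squares:
  fixes X Y :: "'a \<Rightarrow> real"
  assumes [measurable]: "X \<in> borel_measurable M" "Y \<in> borel_measurable M"
    and "integrable M (\<lambda>x. (X x)\<^sup>2)" "integrable M (\<lambda>x. (Y x)\<^sup>2)"
  shows "integrable M (\<lambda>x. X x * Y x)"
proof (rule Bochner_Integration.integrable_bound)
  show "integrable M (\<lambda>x. (X x)\<^sup>2 + (Y x)\<^sup>2)" using assms by simp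
  show "AE x in M. norm (X x * Y x) \<le> norm ((X x)\<^sup>2 + (Y x)\<^sup>2)"
  proof (rule AE_I2)
    fix x
    have "2 * (\<bar>X x\<bar> * \<bar>Y x\<bar>) \<le> (X x)\<^sup>2 + (Y x)\<^sup>2"
      using sum_squares_bound[of "\<bar>X x\<bar>" "\<bar>Y x\<bar>"] by simp
    moreover have "0 \<le> \<bar>X x\<bar> * \<bar>Y x\<bar>" by simp
    ultimately have "\<bar>X x\<bar> * \<bar>Y x\<bar> \<le> (X x)\<^sup>2 + (Y x)\<^sup>2" by linarith
    then show "norm (X x * Y x) \<le> norm ((X x)\<^sup>2 + (Y x)\<^sup>2)" by (simp add: abs_mult)
  qed
qed simp

end

section \<open>The probabilistic model: integrating out renewal and disorder\<close>

locale annealed_pinning = prob_space M + pinning K \<rho>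
  for M :: "'a measure" and K \<rho> :: "nat \<Rightarrow> real" +
  fixes T :: "nat \<Rightarrow> 'a \<Rightarrow> nat" and \<omega> :: "nat \<Rightarrow> 'a \<Rightarrow> real"
  assumes iid: "iid_interarrivals M T"
    and K_eq: "K n = \<P>(x in M. T 1 x = n)"
    and gaussian: "gaussian_sequence M \<omega>"
    and stationary: "stationary_sequence M \<omega>"
    and indep: "indep_sequences M T \<omega>"
    and mean_0: "expectation (\<omega> 0) = 0"
    and variance_1: "expectation (\<lambda>x. (\<omega> 0 x)\<^sup>2) = 1"
    and \<rho>_eq: "n \<ge> 1 \<Longrightarrow> \<rho> n = covariance M (\<omega> 0) (\<omega> n)"
begin

lemma T_measurable: "i \<ge> 1 \<Longrightarrow> T i \<in> measurable M (count_space UNIV)"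
  using iid unfolding iid_interarrivals_def indep_vars_def by blast

lemma T_pos: "x \<in> space M \<Longrightarrow> i \<ge> 1 \<Longrightarrow> T i x \<ge> 1"
  using iid unfolding iid_interarrivals_def by blast

lemma \<omega>_measurable [measurable]: "\<omega> i \<in> borel_measurable M"
  using stationary by (auto simp: stationary_sequence_def)

definition path_event :: "nat list \<Rightarrow> 'a set" where
  "path_event ts = {x \<in> space M. gaps T (length ts) x = ts}"

text \<open>The last intersection with \<open>space M\<close> matters for the empty list, where the
  indexed intersection is the whole type.\<close>

lemma path_event_Int:
  "path_event ts = (\<Inter>i\<in>{1..length ts}. T i -` {ts ! (i - 1)} \<inter> space M) \<inter> space M"
proof -
  have *: "gaps T (length ts) x = ts \<longleftrightarrow> (\<forall>i\<in>{1..length ts}. T i x = ts ! (i - 1))" for x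
  proof -
    have "gaps T (length ts) x = ts \<longleftrightarrow> (\<forall>i\<in>{..<length ts}. T (Suc i) x = ts ! (Suc i - 1))"
      unfolding list_eq_iff_nth_eq[of "gaps T (length ts) x"] by (simp add: gaps_def Ball_def)
    also have "\<dots> \<longleftrightarrow> (\<forall>i\<in>Suc ` {..<length ts}. T i x = ts ! (i - 1))" by blast
    finally show ?thesis by (simp only: image_Suc_lessThan)
  qed
  show ?thesis unfolding path_event_def * by blast
qed

lemma prob_T: "i \<ge> 1 \<Longrightarrow> prob (T i -` {n} \<inter> space M) = K n"
proof -
  assume i: "i \<ge> 1"
  have d: "distr M (count_space UNIV) (T i) = distr M (count_space UNIV) (T 1)"
    using iid i unfolding iid_interarrivals_def by blast
  have "prob (T i -` {n} \<inter> space M) = measure (distr M (count_space UNIV) (T i)) {n}"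
    using T_measurable[OF i] by (simp add: measure_distr)
  also have "\<dots> = prob (T 1 -` {n} \<inter> space M)"
    unfolding d using T_measurable[of 1] by (simp add: measure_distr)
  also have "T 1 -` {n} \<inter> space M = {x \<in> space M. T 1 x = n}" by auto
  finally show ?thesis by (simp add: K_eq)
qed

lemma path_event_sets [measurable]: "path_event ts \<in> events"
proof (cases "ts = []")
  case True
  then show ?thesis by (simp add: path_event_def gaps_def)
next
  case False
  then have "{1..length ts} \<noteq> {}" by (simp add: Suc_le_eq)
  then show ?thesis
    unfolding path_event_Int
    by (intro sets.Int sets.finite_INT measurable_sets[OF T_measurable]) auto
qed

lemma integrable_path_event: "integrable M (indicator (path_event ts) :: 'a \<Rightarrow> real)"
  by (intro integrable_real_indicator path_event_sets) (simp add: less_top[symmetric])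

lemma prob_path_event: "prob (path_event ts) = weight ts"
proof (cases "ts = []")
  case True
  then show ?thesis by (simp add: path_event_Int prob_space)
next
  case False
  then have "1 \<in> {1..length ts}" by (simp add: Suc_le_eq)
  then have "path_event ts = (\<Inter>i\<in>{1..length ts}. T i -` {ts ! (i - 1)} \<inter> space M)"
    unfolding path_event_Int by blast
  also have "prob \<dots> = (\<Prod>i\<in>{1..length ts}. prob (T i -` {ts ! (i - 1)} \<inter> space M))"
  proof (rule indep_varsD)
    show "indep_vars (\<lambda>_. count_space UNIV) T {1..}"
      using iid unfolding iid_interarrivals_def by blast
  qed (use False in \<open>auto simp: Suc_le_eq\<close>)
  also have "\<dots> = (\<Prod>i\<in>{1..length ts}. K (ts ! (i - 1)))"
    by (intro prod.cong refl prob_T) auto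
  also have "\<dots> = (\<Prod>i<length ts. K (ts ! i))"
    by (rule prod.reindex_bij_witness[of _ Suc "\<lambda>i. i - 1"]) auto
  finally show ?thesis
    by (simp add: weight_def prod.list_conv_set_nth lessThan_atLeast0)
qed

text \<open>The path events of the compositions of n partition the event that n is a renewal point.
  The factor g is carried along so that the identity splits an integrand directly.\<close>

lemma indicator_renewal_set:
  assumes "x \<in> space M"
  shows "indicator (renewal_set T x) n * g = (\<Sum>ts\<in>compositions n. indicator (path_event ts) x * g :: real)"
proof -
  have disj: "ts = us" if "ts \<in> compositions n" "us \<in> compositions n" "x \<in> path_event ts" "x \<in> path_event us" for ts us
  proof -
    have gaps: "gaps T (length ts) x = ts" "gaps T (length us) x = us"
      using that by (auto simp: path_event_def)
    then have "n \<in> renewal_set T x"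
      using that(1) sum_list_gaps[of T "length ts" x] by (auto simp: renewal_set_def compositions_def)
    from renewal_set_gaps[where T = T and x = x, OF T_pos[OF assms] this] gaps that(1,2)
    have "length ts = length us" by metis
    with gaps show ?thesis by metis
  qed
  show ?thesis
  proof (cases "n \<in> renewal_set T x")
    case True
    then obtain m where m: "gaps T m x \<in> compositions n"
      using renewal_set_gaps[where T = T and x = x, OF T_pos[OF assms]] by blast
    let ?ts = "gaps T m x"
    have ts: "x \<in> path_event ?ts" using assms by (simp add: path_event_def)
    have "(\<Sum>ts\<in>compositions n. indicator (path_event ts) x * g) =
        (\<Sum>ts\<in>compositions n. if ts = ?ts then g else 0)"
    proof (intro sum.cong refl)
      fix us assume "us \<in> compositions n"
      then have "x \<in> path_event us \<longleftrightarrow> us = ?ts" using disj[OF _ m _ ts] ts by blast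
      then show "indicator (path_event us) x * g = (if us = ?ts then g else 0)"
        by (simp add: indicator_def)
    qed
    then show ?thesis using True m by (simp add: finite_compositions)
  next
    case False
    have "x \<notin> path_event ts" if "ts \<in> compositions n" for ts
      using False that sum_list_gaps[of T "length ts" x]
      by (auto simp: renewal_set_def compositions_def path_event_def)
    then show ?thesis using False by (simp add: sum.neutral)
  qed
qed

lemma prob_renewal: "\<P>(x in M. n \<in> renewal_set T x) = renewal_mass n"
proof -
  let ?A = "{x \<in> space M. n \<in> renewal_set T x}"
  have ind: "indicator ?A x = (\<Sum>ts\<in>compositions n. indicator (path_event ts) x :: real)"
    if "x \<in> space M" for x
    using indicator_renewal_set[OF that, of n 1] that by (simp add: indicator_def)
  have "x \<in> ?A \<longleftrightarrow> (\<exists>ts\<in>compositions n. x \<in> path_event ts)" if "x \<in> space M" for x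
  proof -
    have "x \<in> ?A \<longleftrightarrow> indicator ?A x \<noteq> (0 :: real)" by (simp add: indicator_def)
    also have "\<dots> \<longleftrightarrow> (\<exists>ts\<in>compositions n. x \<in> path_event ts)"
      unfolding ind[OF that] by (subst sum_nonneg_eq_0_iff) (auto simp: finite_compositions indicator_def)
    finally show ?thesis .
  qed
  then have "?A = (\<Union>ts\<in>compositions n. path_event ts)"
    by (auto simp: path_event_def)
  then have A: "?A \<in> events" by (auto intro!: sets.finite_UN finite_compositions)
  then have "prob ?A = expectation (indicator ?A)" by simp
  also have "\<dots> = expectation (\<lambda>x. \<Sum>ts\<in>compositions n. indicator (path_event ts) x)"
    by (intro Bochner_Integration.integral_cong refl ind)
  also have "\<dots> = renewal_mass n"
    using path_event_sets
    by (subst Bochner_Integration.integral_sum[OF integrable_path_event])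
       (simp_all add: prob_path_event renewal_mass_def)
  finally show ?thesis .
qed

lemma gaussian_linear: "gaussian_rv M (\<lambda>x. \<Sum>i\<le>N. c i * \<omega> i x)"
  using gaussian by (simp add: gaussian_sequence_def)

lemma \<omega>_gaussian: "gaussian_rv M (\<omega> i)"
proof -
  have "(\<Sum>j\<le>i. of_bool (j = i) * \<omega> j x) = \<omega> i x" for x
    by (simp add: of_bool_def if_distrib[of "\<lambda>a. a * _"] cong: if_cong)
  with gaussian_linear[of "\<lambda>j. of_bool (j = i)" i] show ?thesis by simp
qed

lemma \<omega>_mult_integrable: "integrable M (\<lambda>x. \<omega> i x * \<omega> j x)"
  by (intro integrable_mult_of_squares gaussian_square_integrable \<omega>_gaussian \<omega>_measurable)

lemma \<omega>_integrable: "integrable M (\<omega> i)"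
  using square_integrable_imp_integrable[OF \<omega>_measurable gaussian_square_integrable[OF \<omega>_gaussian]] .

lemma expectation_shift:
  assumes [measurable]: "g \<in> borel_measurable (Pi\<^sub>M UNIV (\<lambda>_. borel))"
  shows "expectation (\<lambda>x. g (\<lambda>i. \<omega> (i + m) x)) = (expectation (\<lambda>x. g (\<lambda>i. \<omega> i x)) :: real)"
proof -
  let ?P = "Pi\<^sub>M UNIV (\<lambda>_. borel) :: (nat \<Rightarrow> real) measure"
  have [measurable]: "(\<lambda>x i. \<omega> (i + m) x) \<in> measurable M ?P" for m
    by (rule measurable_PiM_single') auto
  have [measurable]: "(\<lambda>x i. \<omega> i x) \<in> measurable M ?P"
    by (rule measurable_PiM_single') auto
  have "expectation (\<lambda>x. g (\<lambda>i. \<omega> (i + m) x)) = integral\<^sup>L (distr M ?P (\<lambda>x i. \<omega> (i + m) x)) g"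
    by (subst integral_distr) auto
  also have "distr M ?P (\<lambda>x i. \<omega> (i + m) x) = distr M ?P (\<lambda>x i. \<omega> i x)"
    using stationary by (simp add: stationary_sequence_def)
  also have "integral\<^sup>L (distr M ?P (\<lambda>x i. \<omega> i x)) g = expectation (\<lambda>x. g (\<lambda>i. \<omega> i x))"
    by (subst integral_distr) auto
  finally show ?thesis .
qed

lemma expectation_\<omega>: "expectation (\<omega> i) = 0"
  using expectation_shift[of "\<lambda>y. y 0" i] mean_0 by simp

lemma expectation_\<omega>_mult: "expectation (\<lambda>x. \<omega> i x * \<omega> j x) = corr i j"
proof -
  have *: "expectation (\<lambda>x. \<omega> i x * \<omega> (k + i) x) = corr i (k + i)" for i k
  proof -
    have "expectation (\<lambda>x. \<omega> i x * \<omega> (k + i) x) = expectation (\<lambda>x. \<omega> 0 x * \<omega> k x)"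
      using expectation_shift[of "\<lambda>y. y 0 * y k" i] by simp
    also have "\<dots> = corr i (k + i)"
      using variance_1 \<rho>_eq[of k] expectation_\<omega>
      by (cases "k = 0") (auto simp: corr_def covariance_def power2_eq_square)
    finally show ?thesis .
  qed
  show ?thesis
  proof (cases "i \<le> j")
    case True
    then show ?thesis using *[of i "j - i"] by simp
  next
    case False
    then show ?thesis using *[of j "i - j"] by (simp add: mult.commute corr_commute)
  qed
qed

lemma expectation_linear: "expectation (\<lambda>x. \<Sum>i\<le>N. c i * \<omega> i x) = 0"
  using \<omega>_integrable by (simp add: expectation_\<omega>)

lemma expectation_linear_square:
  "expectation (\<lambda>x. (\<Sum>i\<le>N. c i * \<omega> i x)\<^sup>2) = bilinear_form N c c"
proof -
  have "(\<Sum>i\<le>N. c i * \<omega> i x)\<^sup>2 = (\<Sum>i\<le>N. \<Sum>j\<le>N. c i * c j * (\<omega> i x * \<omega> j x))" for x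
    by (simp add: power2_eq_square sum_product mult_ac)
  then show ?thesis
    using \<omega>_mult_integrable by (simp add: expectation_\<omega>_mult bilinear_form_def)
qed

lemma bilinear_form_nonneg: "bilinear_form N c c \<ge> 0"
  unfolding expectation_linear_square[symmetric] by simp

text \<open>A path event is a cylinder set in the coordinates T, and X is a measurable function of
  the sequence \<omega>. Independence of the two generated sigma-algebras therefore passes to these
  two variables, and the expectation factorizes.\<close>

lemma expectation_path_event_exp:
  fixes c :: "nat \<Rightarrow> real" and N :: nat
  defines "X \<equiv> \<lambda>x. exp (\<Sum>i\<le>N. c i * \<omega> i x)"
  shows "integrable M (\<lambda>x. indicator (path_event ts) x * X x)"
    and "expectation (\<lambda>x. indicator (path_event ts) x * X x) = weight ts * exp (bilinear_form N c c / 2)"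
proof -
  let ?TT = "\<lambda>x. \<lambda>i\<in>{1..}. T i x" and ?\<omega>\<omega> = "\<lambda>x i. \<omega> i x"
  let ?PT = "Pi\<^sub>M {1..} (\<lambda>_. count_space UNIV) :: (nat \<Rightarrow> nat) measure"
  let ?P\<omega> = "Pi\<^sub>M UNIV (\<lambda>_. borel) :: (nat \<Rightarrow> real) measure"
  let ?AT = "sets (vimage_algebra (space M) ?TT ?PT)"
  let ?A\<omega> = "sets (vimage_algebra (space M) ?\<omega>\<omega> ?P\<omega>)"
  have indep': "indep_set ?AT ?A\<omega>"
    using indep by (simp add: indep_sequences_def)
  let ?I = "indicator (path_event ts) :: 'a \<Rightarrow> real"
  have TT: "?TT \<in> space M \<rightarrow> space ?PT" by (auto simp: space_PiM)
  have IT: "?I -` A \<inter> space M \<in> ?AT" if "A \<in> sets borel" for A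
  proof -
    let ?S = "{y \<in> space ?PT. \<forall>i\<in>{1..length ts}. y i = ts ! (i - 1)}"
    have S: "?S \<in> sets ?PT" by measurable
    have "path_event ts = ?TT -` ?S \<inter> space M"
      unfolding path_event_Int using TT by (auto simp: space_PiM PiE_def extensional_def)
    then have "path_event ts \<in> ?AT" using in_vimage_algebra[OF S, of ?TT "space M"] by simp
    then have "?I \<in> borel_measurable (vimage_algebra (space M) ?TT ?PT)" by simp
    from measurable_sets[OF this that] show ?thesis by simp
  qed
  have X\<omega>: "X -` A \<inter> space M \<in> ?A\<omega>" if "A \<in> sets borel" for A
  proof -
    let ?g = "\<lambda>y. exp (\<Sum>i\<le>N. c i * y i)"
    have g: "?g \<in> borel_measurable ?P\<omega>" by measurable
    have "?g \<circ> ?\<omega>\<omega> \<in> borel_measurable (vimage_algebra (space M) ?\<omega>\<omega> ?P\<omega>)"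
      by (rule measurable_comp[OF measurable_vimage_algebra1 g]) (auto simp: space_PiM)
    then have "X \<in> borel_measurable (vimage_algebra (space M) ?\<omega>\<omega> ?P\<omega>)" by (simp add: X_def o_def)
    from measurable_sets[OF this that] show ?thesis by simp
  qed
  have [measurable]: "X \<in> borel_measurable M" unfolding X_def by measurable
  have iv: "indep_var borel ?I borel X"
    unfolding indep_var_eq
  proof (intro conjI indep_setI)
    have "{?I -` A \<inter> space M | A. A \<in> sets borel} \<subseteq> ?AT" using IT by blast
    from sets.sigma_sets_subset[OF this]
    have sub: "sigma_sets (space M) {?I -` A \<inter> space M | A. A \<in> sets borel} \<subseteq> ?AT"
      by (simp only: space_vimage_algebra)
    have "{X -` A \<inter> space M | A. A \<in> sets borel} \<subseteq> ?A\<omega>" using X\<omega> by blast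
    from sets.sigma_sets_subset[OF this]
    have sub': "sigma_sets (space M) {X -` A \<inter> space M | A. A \<in> sets borel} \<subseteq> ?A\<omega>"
      by (simp only: space_vimage_algebra)
    show "sigma_sets (space M) {?I -` A \<inter> space M | A. A \<in> sets borel} \<subseteq> events"
      using sub indep_setD_ev1[OF indep'] by blast
    show "sigma_sets (space M) {X -` A \<inter> space M | A. A \<in> sets borel} \<subseteq> events"
      using sub' indep_setD_ev2[OF indep'] by blast
    show "prob (a \<inter> b) = prob a * prob b"
      if "a \<in> sigma_sets (space M) {?I -` A \<inter> space M | A. A \<in> sets borel}"
         "b \<in> sigma_sets (space M) {X -` A \<inter> space M | A. A \<in> sets borel}" for a b
      using that sub sub' by (intro indep_setD[OF indep']) auto
  qed simp_all
  have X: "integrable M X" "expectation X = exp (bilinear_form N c c / 2)"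
    using gaussian_expectation_exp[OF gaussian_linear[where N = N and c = c] expectation_linear]
    by (simp_all add: X_def expectation_linear_square)
  have I: "integrable M ?I" by (rule integrable_path_event)
  show "integrable M (\<lambda>x. ?I x * X x)"
    by (rule indep_var_integrable[OF iv I X(1)])
  show "expectation (\<lambda>x. ?I x * X x) = weight ts * exp (bilinear_form N c c / 2)"
    using indep_var_lebesgue_integral[OF iv I X(1)] X(2) by (simp add: prob_path_event)
qed

text \<open>On a path event the contacts are frozen, so the exponent is a fixed linear combination
  of \<omega> plus h per contact. Half its variance is beta^2/2 per contact plus beta^2 times the
  energy.\<close>

lemma annealed_Z_eq: "annealed_Z M T \<omega> \<beta> h n = Z (h + \<beta>\<^sup>2 / 2) (\<beta>\<^sup>2) n"
proof -
  let ?c = "\<lambda>ts i. \<beta> * visits 0 ts i"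
  let ?f = "\<lambda>ts x. exp (h * length ts) * (indicator (path_event ts) x * exp (\<Sum>i\<le>n. ?c ts i * \<omega> i x))"
  have "annealed_Z M T \<omega> \<beta> h n = expectation (\<lambda>x. \<Sum>ts\<in>compositions n. ?f ts x)"
    unfolding annealed_Z_def
  proof (rule Bochner_Integration.integral_cong[OF refl])
    fix x assume x: "x \<in> space M"
    let ?E = "exp (\<Sum>k=1..n. (\<beta> * \<omega> k x + h) * contact T k x)"
    have "?E * contact T n x = (\<Sum>ts\<in>compositions n. indicator (path_event ts) x * ?E)"
      using indicator_renewal_set[OF x, of n ?E] by (simp add: contact_def mult.commute)
    also have "\<dots> = (\<Sum>ts\<in>compositions n. ?f ts x)"
    proof (intro sum.cong refl)
      fix ts assume ts: "ts \<in> compositions n"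
      show "indicator (path_event ts) x * ?E = ?f ts x"
      proof (cases "x \<in> path_event ts")
        case True
        then have gaps: "gaps T (length ts) x = ts" by (simp add: path_event_def)
        have "(\<Sum>k=1..n. (\<beta> * \<omega> k x + h) * contact T k x) = psum (\<lambda>k. \<beta> * \<omega> k x + h) 0 ts"
          using sum_contact[where T = T and x = x, OF T_pos[OF x], of "length ts" n] ts gaps by simp
        also have "\<dots> = (\<Sum>i\<le>n. visits 0 ts i * (\<beta> * \<omega> i x)) + h * length ts"
        proof -
          have "psum (\<lambda>k. f k + h) s ts = psum f s ts + h * length ts" for f s ts
            by (induction ts arbitrary: s) (auto simp: algebra_simps)
          then show ?thesis using sum_visits[of 0 ts n "\<lambda>k. \<beta> * \<omega> k x"] ts
            by (simp add: compositions_def)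
        qed
        finally show ?thesis using True by (simp add: exp_add mult_ac)
      qed simp
    qed
    finally show "?E * contact T n x = (\<Sum>ts\<in>compositions n. ?f ts x)" .
  qed
  also have "\<dots> = (\<Sum>ts\<in>compositions n. exp (h * length ts) * (weight ts * exp (bilinear_form n (?c ts) (?c ts) / 2)))"
    using expectation_path_event_exp by simp
  also have "\<dots> = Z (h + \<beta>\<^sup>2 / 2) (\<beta>\<^sup>2) n"
    unfolding Z_def
  proof (intro sum.cong refl)
    fix ts assume ts: "ts \<in> compositions n"
    have "bilinear_form n (?c ts) (?c ts) = \<beta>\<^sup>2 * (length ts + 2 * energy \<rho> ts)"
      using ts bilinear_form_visits[of 0 ts n]
      by (simp add: bilinear_form_scale_left bilinear_form_scale_right compositions_def power2_eq_square)
    then show "exp (h * length ts) * (weight ts * exp (bilinear_form n (?c ts) (?c ts) / 2)) =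
        weight ts * exp ((h + \<beta>\<^sup>2 / 2) * length ts + \<beta>\<^sup>2 * energy \<rho> ts)"
      by (simp add: exp_add[symmetric] algebra_simps add_divide_distrib)
  qed
  finally show ?thesis .
qed

lemma annealed_free_energy_eq: "annealed_free_energy M T \<omega> \<beta> h = free_energy (h + \<beta>\<^sup>2 / 2) (\<beta>\<^sup>2)"
  by (simp add: annealed_free_energy_def annealed_Z_eq free_energy_def)

text \<open>At the lower value the free energy is both nonpositive and nonnegative, so this value
  lies in the set whose supremum is taken. At the upper value it is positive, and by monotonicity it
  stays so above: the set is nonempty and bounded, and its supremum is trapped.\<close>

lemma critical_point_bounds:
  assumes K_dyadic: "(\<lambda>k. ln (K (2 ^ k)) / 2 ^ k) \<longlonglongrightarrow> 0" and \<epsilon>: "\<epsilon> > 0"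
  shows "\<forall>\<^sub>F \<beta> in at_right 0.
    - (\<beta>\<^sup>2 / 2) * (1 + 2 * (\<kappa> + \<epsilon>)) \<le> annealed_critical_point M T \<omega> \<beta> \<and>
    annealed_critical_point M T \<omega> \<beta> \<le> - (\<beta>\<^sup>2 / 2) * (1 + 2 * (\<kappa> - \<epsilon>))"
proof -
  obtain b0 where b0: "b0 > 0" "\<And>b. 0 \<le> b \<Longrightarrow> b \<le> b0 \<Longrightarrow> free_energy (- b * (\<kappa> + \<epsilon>)) b \<le> 0"
    using free_energy_nonpos[OF \<epsilon>] by blast
  have "\<forall>\<^sub>F \<beta> in at_right 0. \<beta> < sqrt b0"
    unfolding eventually_at_right_field using b0(1) by (intro exI[of _ "sqrt b0"]) auto
  moreover have "\<forall>\<^sub>F \<beta> in at_right (0::real). \<beta> > 0" by (rule eventually_at_right_less)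
  ultimately show ?thesis
  proof eventually_elim
    case (elim \<beta>)
    define b where "b = \<beta>\<^sup>2"
    have "\<beta>\<^sup>2 < (sqrt b0)\<^sup>2" using elim by (intro power_strict_mono) auto
    then have b: "0 < b" "b \<le> b0" using elim b0(1) by (auto simp: b_def)
    let ?S = "{h. annealed_free_energy M T \<omega> \<beta> h = 0}"
    let ?lo = "- b * (\<kappa> + \<epsilon>) - b / 2" and ?hi = "- b * (\<kappa> - \<epsilon>) - b / 2"
    have "free_energy (- b * (\<kappa> + \<epsilon>)) b = 0"
      using b0(2)[of b] free_energy_nonneg[OF _ K_dyadic, of b] b by (intro antisym) auto
    then have lo: "?lo \<in> ?S" by (simp add: annealed_free_energy_eq b_def[symmetric])
    have hi: "h \<le> ?hi" if "h \<in> ?S" for h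
    proof (rule ccontr)
      assume "\<not> h \<le> ?hi"
      then have "free_energy (- b * (\<kappa> - \<epsilon>)) b \<le> free_energy (h + b / 2) b"
        using b by (intro free_energy_mono) auto
      with free_energy_pos[OF \<epsilon> b(1)] that show False
        by (simp add: annealed_free_energy_eq b_def[symmetric])
    qed
    have "?lo \<le> Sup ?S" using lo hi by (intro cSup_upper) (auto simp: bdd_above_def)
    moreover have "Sup ?S \<le> ?hi" using lo hi by (intro cSup_least) auto
    moreover have "- (\<beta>\<^sup>2 / 2) * (1 + 2 * (\<kappa> + \<epsilon>)) = ?lo" "- (\<beta>\<^sup>2 / 2) * (1 + 2 * (\<kappa> - \<epsilon>)) = ?hi"
      by (simp_all add: b_def field_simps)
    ultimately show ?case by (simp only: annealed_critical_point_def)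
  qed
qed

lemma critical_point_asymptotics:
  assumes "(\<lambda>k. ln (K (2 ^ k)) / 2 ^ k) \<longlonglongrightarrow> 0"
  shows "((\<lambda>\<beta>. annealed_critical_point M T \<omega> \<beta> / (- (\<beta>\<^sup>2 / 2) * (1 + 2 * \<kappa>))) \<longlongrightarrow> 1) (at_right 0)"
proof (rule tendstoI)
  fix e :: real assume e: "e > 0"
  let ?C = "1 + 2 * \<kappa>"
  have C: "?C > 0" by (rule one_plus_two_\<kappa>_pos[OF bilinear_form_nonneg])
  \<comment> \<open>The absolute error is at most 2 \<epsilon> times beta^2/2, so the relative error
    is 2 \<epsilon> divided by 1 + 2 \<kappa>, that is e / 2.\<close>
  define \<epsilon> where "\<epsilon> = e * ?C / 4"
  have \<epsilon>: "\<epsilon> > 0" using e C by (simp add: \<epsilon>_def)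
  have "\<forall>\<^sub>F \<beta> in at_right (0::real). \<beta> > 0" by (rule eventually_at_right_less)
  with critical_point_bounds[OF assms \<epsilon>]
  show "\<forall>\<^sub>F \<beta> in at_right 0. dist (annealed_critical_point M T \<omega> \<beta> / (- (\<beta>\<^sup>2 / 2) * ?C)) 1 < e"
  proof eventually_elim
    case (elim \<beta>)
    let ?h = "annealed_critical_point M T \<omega> \<beta>"
    define a where "a = \<beta>\<^sup>2 / 2"
    have a: "a > 0" using elim by (simp add: a_def)
    define y where "y = - a * ?C"
    have y: "y \<noteq> 0" "\<bar>y\<bar> = a * ?C" using a C by (auto simp: y_def abs_mult)
    have le: "\<bar>?h - y\<bar> \<le> a * (2 * \<epsilon>)"
      using elim by (simp add: y_def a_def[symmetric] abs_le_iff algebra_simps)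
    have "?h / y - 1 = (?h - y) / y" using y(1) by (simp add: diff_divide_distrib)
    then have "\<bar>?h / y - 1\<bar> = \<bar>?h - y\<bar> / (a * ?C)" by (simp only: abs_divide y(2))
    also have "\<dots> \<le> a * (2 * \<epsilon>) / (a * ?C)"
      using a C by (intro divide_right_mono le) auto
    also have "\<dots> = e / 2"
    proof -
      have "x * (2 * (e * z / 4)) / (x * z) = e / 2" if "x > 0" "z > 0" for x z :: real
        using that by simp
      from this[OF a C] show ?thesis by (simp only: \<epsilon>_def)
    qed
    also have "\<dots> < e" using e by simp
    finally show ?case by (simp only: dist_real_def y_def a_def)
  qed
qed

end

text \<open>From some point on, doubling the argument divides L by less than 2. Hence ln L(2^k) is
  at least a constant minus k ln 2, and the power factor in K adds another multiple of k; both
  vanish against 2^k. The upper side is K <= 1.\<close>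

lemma slowly_varying_dyadic:
  fixes L :: "real \<Rightarrow> real" and K :: "nat \<Rightarrow> real"
  assumes "slowly_varying L" "\<alpha> \<ge> 0"
    and K_eq: "\<And>n. n \<ge> 1 \<Longrightarrow> K n = L (real n) * real n powr (-(1 + \<alpha>))"
    and K_pos: "\<And>n. n \<ge> 1 \<Longrightarrow> 0 < K n" and K_le: "\<And>n. n \<ge> 1 \<Longrightarrow> K n \<le> 1"
  shows "(\<lambda>k. ln (K (2 ^ k)) / 2 ^ k) \<longlonglongrightarrow> 0"
proof -
  \<comment> \<open>Slow variation gives positivity only near infinity; at all powers of 2 it
    follows from K > 0.\<close>
  have L_pos: "L (2 ^ k) > 0" for k
    using K_pos[of "2 ^ k"] K_eq[of "2 ^ k"] by (simp add: zero_less_mult_iff)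
  have "((\<lambda>x. L (2 * x) / L x) \<longlongrightarrow> 1) at_top"
    using assms(1) by (simp add: slowly_varying_def)
  then have "\<forall>\<^sub>F x in at_top. L (2 * x) / L x > 1 / 2" by (intro order_tendstoD) auto
  moreover have "filterlim (\<lambda>k::nat. 2 ^ k :: real) at_top sequentially" by real_asymp
  ultimately have "\<forall>\<^sub>F k in sequentially. L (2 * 2 ^ k) / L (2 ^ k) > 1 / 2"
    by (rule eventually_compose_filterlim)
  then obtain k0 where k0: "\<And>k. k \<ge> k0 \<Longrightarrow> L (2 * 2 ^ k) / L (2 ^ k) > 1 / 2"
    by (auto simp: eventually_sequentially)
  have low: "L (2 ^ (k0 + j)) \<ge> L (2 ^ k0) * (1 / 2) ^ j" for j
  proof (induction j)
    case (Suc j)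
    have "L (2 ^ (k0 + j)) * (1 / 2) \<le> L (2 ^ (k0 + Suc j))"
      using k0[of "k0 + j"] L_pos[of "k0 + j"] by (simp add: field_simps)
    with Suc show ?case by simp
  qed simp
  define c where "c = ln (L (2 ^ k0))"
  have lim: "(\<lambda>k. (c - real k * ln 2 - real k * ln 2 * (1 + \<alpha>)) / 2 ^ k) \<longlonglongrightarrow> 0" by real_asymp
  have lower: "\<forall>\<^sub>F k in sequentially.
      (c - real k * ln 2 - real k * ln 2 * (1 + \<alpha>)) / 2 ^ k \<le> ln (K (2 ^ k)) / 2 ^ k"
    using eventually_ge_at_top[of k0]
  proof eventually_elim
    case (elim k)
    define j where "j = k - k0"
    have "ln (L (2 ^ k0) * (1 / 2) ^ j) \<le> ln (L (2 ^ k))"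
      using low[of j] elim L_pos[of k0] by (intro ln_mono) (auto simp: j_def)
    also have "ln (L (2 ^ k0) * (1 / 2) ^ j) = c - real j * ln 2"
      using L_pos[of k0] by (simp add: c_def ln_mult ln_realpow ln_div)
    moreover have "real j * ln 2 \<le> real k * ln 2"
      by (intro mult_right_mono) (auto simp: j_def)
    ultimately have "c - real k * ln 2 \<le> ln (L (2 ^ k))" by linarith
    moreover have "ln (K (2 ^ k)) = ln (L (2 ^ k)) - real k * ln 2 * (1 + \<alpha>)"
      using L_pos[of k] K_eq[of "2 ^ k"]
      by (simp add: ln_mult ln_powr ln_realpow algebra_simps)
    ultimately show ?case by (intro divide_right_mono) auto
  qed
  have upper: "\<forall>\<^sub>F k in sequentially. ln (K (2 ^ k)) / 2 ^ k \<le> 0"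
    using K_pos K_le by (intro always_eventually allI divide_nonpos_pos) (auto simp: ln_le_zero_iff)
  show ?thesis by (rule tendsto_sandwich[OF lower upper lim tendsto_const])
qed

theorem theorem2p3:
  fixes M :: "'a measure"
    and T :: "nat \<Rightarrow> 'a \<Rightarrow> nat"
    and \<omega> :: "nat \<Rightarrow> 'a \<Rightarrow> real"
    and K :: "nat \<Rightarrow> real"
    and L :: "real \<Rightarrow> real"
    and \<alpha> :: real
    and \<rho> :: "nat \<Rightarrow> real"
  assumes "prob_space M"
    and "iid_interarrivals M T"
    and "\<And>n. K n = \<P>(x in M. T 1 x = n)"
    and "\<alpha> \<ge> 0"
    and "slowly_varying L"
    and "\<And>n. n \<ge> 1 \<Longrightarrow> K n = L (real n) * real n powr (-(1 + \<alpha>))"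
    and "\<And>n. n \<ge> 1 \<Longrightarrow> K n > 0"
    and "(\<lambda>n. K (Suc n)) sums 1"
    and "gaussian_sequence M \<omega>"
    and "stationary_sequence M \<omega>"
    and "indep_sequences M T \<omega>"
    and "(LINT x|M. \<omega> 0 x) = 0"
    and "(LINT x|M. (\<omega> 0 x)\<^sup>2) = 1"
    and "\<And>n. n \<ge> 1 \<Longrightarrow> \<rho> n = covariance M (\<omega> 0) (\<omega> n)"
    and "summable (\<lambda>n. \<bar>\<rho> (Suc n)\<bar>)"
  shows "((\<lambda>\<beta>. annealed_critical_point M T \<omega> \<beta> /
              (- (\<beta>\<^sup>2 / 2) *
                (1 + 2 * (\<Sum>n. \<rho> (Suc n) * \<P>(x in M. Suc n \<in> renewal_set T x)))))
          \<longlongrightarrow> 1) (at_right 0)"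
proof -
  interpret prob_space M by (rule assms(1))
  interpret annealed_pinning M K \<rho> T \<omega>
    by unfold_locales (fact assms)+
  have "(\<lambda>k. ln (K (2 ^ k)) / 2 ^ k) \<longlonglongrightarrow> 0"
    by (rule slowly_varying_dyadic[OF assms(5,4,6,7)]) (simp_all add: K_eq)
  from critical_point_asymptotics[OF this] show ?thesis
    by (simp only: \<kappa>_def prob_renewal)
qed

end
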